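(* Let $p>3$ be an odd prime with $p\equiv 1\bmod 4$, and let $q$ be any odd power of $p$ (that is, $q=p^k$ with $k$ an odd positive integer). Then for any positive integer $j$ the Sylow $p$-subgroups of $\mathrm{Sp}_{p^j+1}(q)$ and of $\mathrm{PSp}_{p^j+1}(q)$ are non-$FSZ_{p^j}$.
   Context: For a positive integer $n$, $\mathrm{Sp}_{2n}(q)$ is the group of isometries of a $2n$-dimensional vector space over the finite field $\mathbb{F}_q$ equipped with a (non-degenerate) symplectic form, and $\mathrm{PSp}_{2n}(q)=\mathrm{Sp}_{2n}(q)/Z(\mathrm{Sp}_{2n}(q))$. For a finite group $G$, a positive integer $m$, and $u,g\in G$, define $G_m(u,g)=\{a\in G : a^m=(au)^m=g\}$. The group $G$ is $FSZ_m$ if for every positive integer $n$ coprime to $|G|$ and all $u,g\in G$ we have $|G_m(u,g)|=|G_m(u,g^n)|$. The group $G$ is non-$FSZ_m$ if it is not $FSZ_m$. *)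

theory Defs
  imports
    Complex_Main
    "HOL-Algebra.Sylow"
    "HOL-Number_Theory.Cong"
    "HOL-Library.Cardinality"
begin

text \<open>
  A vector space with a non-degenerate symplectic (alternating bilinear) form. The vector space is
  the whole type \<open>'v\<close>; its dimension is \<open>vector_space.dim scale UNIV\<close>, which
  is positive only if the space is finite-dimensional.
\<close>

locale symplectic_space = vector_space scale
  for scale :: "'f::field \<Rightarrow> 'v::ab_group_add \<Rightarrow> 'v" +
  fixes form :: "'v \<Rightarrow> 'v \<Rightarrow> 'f"
  assumes linear_left: "\<And>y. Vector_Spaces.linear scale (*) (\<lambda>x. form x y)"
    and linear_right: "\<And>x. Vector_Spaces.linear scale (*) (\<lambda>y. form x y)"
    and alternating: "\<And>x. form x x = 0"
    and nondegenerate: "\<And>x. (\<And>y. form x y = 0) \<Longrightarrow> x = 0"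

definition Sp :: "('f::field \<Rightarrow> 'v::ab_group_add \<Rightarrow> 'v) \<Rightarrow> ('v \<Rightarrow> 'v \<Rightarrow> 'f) \<Rightarrow> ('v \<Rightarrow> 'v) monoid" where
  "Sp scale form =
    \<lparr>carrier = {f. Vector_Spaces.linear scale scale f \<and> bij f \<and> (\<forall>x y. form (f x) (f y) = form x y)},
     monoid.mult = (\<circ>), one = id\<rparr>"

definition group_center :: "('a, 'b) monoid_scheme \<Rightarrow> 'a set" where
  "group_center G = {z \<in> carrier G. \<forall>x \<in> carrier G. z \<otimes>\<^bsub>G\<^esub> x = x \<otimes>\<^bsub>G\<^esub> z}"

definition PSp :: "('f::field \<Rightarrow> 'v::ab_group_add \<Rightarrow> 'v) \<Rightarrow> ('v \<Rightarrow> 'v \<Rightarrow> 'f) \<Rightarrow> ('v \<Rightarrow> 'v) set monoid" where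
  "PSp scale form = Sp scale form Mod group_center (Sp scale form)"

text \<open>Meaningful for finite \<open>G\<close> only: \<open>order G\<close> is \<open>0\<close> for infinite \<open>G\<close>.\<close>

definition sylow_subgroup :: "nat \<Rightarrow> ('a, 'b) monoid_scheme \<Rightarrow> 'a set \<Rightarrow> bool" where
  "sylow_subgroup p G P \<longleftrightarrow> subgroup P G \<and> card P = p ^ multiplicity p (order G)"

definition FSZ_set :: "('a, 'b) monoid_scheme \<Rightarrow> nat \<Rightarrow> 'a \<Rightarrow> 'a \<Rightarrow> 'a set" where
  "FSZ_set G m u g = {a \<in> carrier G. a [^]\<^bsub>G\<^esub> m = g \<and> (a \<otimes>\<^bsub>G\<^esub> u) [^]\<^bsub>G\<^esub> m = g}"

definition FSZ :: "nat \<Rightarrow> ('a, 'b) monoid_scheme \<Rightarrow> bool" where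
  "FSZ m G \<longleftrightarrow>
    (\<forall>n::nat. n > 0 \<and> coprime n (order G) \<longrightarrow>
      (\<forall>u \<in> carrier G. \<forall>g \<in> carrier G.
        card (FSZ_set G m u g) = card (FSZ_set G m u (g [^]\<^bsub>G\<^esub> n))))"

lemma (in group) group_center_normal: "group_center G \<lhd> G"
proof (rule normal_invI)
  show "subgroup (group_center G) G"
  proof (rule subgroupI)
    show "group_center G \<subseteq> carrier G" by (auto simp: group_center_def)
    have "\<one> \<in> group_center G" by (simp add: group_center_def)
    then show "group_center G \<noteq> {}" by blast
  next
    fix a assume "a \<in> group_center G"
    then have a: "a \<in> carrier G" and comm: "\<And>x. x \<in> carrier G \<Longrightarrow> a \<otimes> x = x \<otimes> a"
      by (auto simp: group_center_def)
    have "inv a \<otimes> x = x \<otimes> inv a" if x: "x \<in> carrier G" for x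
    proof -
      have "inv a \<otimes> x = inv (inv x \<otimes> a)" using a x by (simp add: inv_mult_group)
      also have "inv x \<otimes> a = a \<otimes> inv x" using comm[of "inv x"] x by simp
      also have "inv (a \<otimes> inv x) = x \<otimes> inv a" using a x by (simp add: inv_mult_group)
      finally show ?thesis .
    qed
    then show "inv a \<in> group_center G" using a by (simp add: group_center_def)
  next
    fix a b assume "a \<in> group_center G" "b \<in> group_center G"
    then have ab: "a \<in> carrier G" "b \<in> carrier G"
      and comm: "\<And>x. x \<in> carrier G \<Longrightarrow> a \<otimes> x = x \<otimes> a" "\<And>x. x \<in> carrier G \<Longrightarrow> b \<otimes> x = x \<otimes> b"
      by (auto simp: group_center_def)
    have "(a \<otimes> b) \<otimes> x = x \<otimes> (a \<otimes> b)" if x: "x \<in> carrier G" for x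
    proof -
      have "(a \<otimes> b) \<otimes> x = a \<otimes> (x \<otimes> b)" using ab x comm(2)[OF x] by (simp add: m_assoc)
      also have "\<dots> = (x \<otimes> a) \<otimes> b" using ab x comm(1)[OF x] by (simp flip: m_assoc)
      finally show ?thesis using ab x by (simp add: m_assoc)
    qed
    then show "a \<otimes> b \<in> group_center G" using ab by (simp add: group_center_def)
  qed
next
  fix x h assume x: "x \<in> carrier G" and h: "h \<in> group_center G"
  then have "h \<in> carrier G" "x \<otimes> h = h \<otimes> x" by (auto simp: group_center_def)
  then have "x \<otimes> h \<otimes> inv x = h" using x by (simp add: m_assoc)
  then show "x \<otimes> h \<otimes> inv x \<in> group_center G" using h by simp
qed

lemma (in vector_space) group_Sp: "group (Sp scale form)"
proof (rule groupI)
  fix f assume f: "f \<in> carrier (Sp scale form)"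
  then have lin: "Vector_Spaces.linear scale scale f" and "bij f"
    and iso: "\<And>x y. form (f x) (f y) = form x y"
    by (auto simp: Sp_def)
  have inv: "f (inv_into UNIV f x) = x" "inv_into UNIV f (f x) = x" for x
    using \<open>bij f\<close> by (simp_all add: bij_is_surj surj_f_inv_f bij_is_inj)
  interpret l: Vector_Spaces.linear scale scale f by (fact lin)
  have "Vector_Spaces.linear scale scale (inv_into UNIV f)"
  proof unfold_locales
    show "inv_into UNIV f (x + y) = inv_into UNIV f x + inv_into UNIV f y" for x y
      using inv(2)[of "inv_into UNIV f x + inv_into UNIV f y"] by (simp only: l.add inv(1))
    show "inv_into UNIV f (scale c x) = scale c (inv_into UNIV f x)" for c x
      using inv(2)[of "scale c (inv_into UNIV f x)"] by (simp only: l.scale inv(1))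
  qed
  moreover have "form (inv_into UNIV f x) (inv_into UNIV f y) = form x y" for x y
    using iso[of "inv_into UNIV f x" "inv_into UNIV f y"] by (simp add: inv)
  ultimately have "inv_into UNIV f \<in> carrier (Sp scale form)"
    using \<open>bij f\<close> by (simp add: Sp_def bij_imp_bij_inv)
  moreover have "inv_into UNIV f \<otimes>\<^bsub>Sp scale form\<^esub> f = \<one>\<^bsub>Sp scale form\<^esub>"
    by (simp add: Sp_def fun_eq_iff inv)
  ultimately show "\<exists>g \<in> carrier (Sp scale form). g \<otimes>\<^bsub>Sp scale form\<^esub> f = \<one>\<^bsub>Sp scale form\<^esub>"
    by blast
next
  fix f g assume "f \<in> carrier (Sp scale form)" "g \<in> carrier (Sp scale form)"
  then show "f \<otimes>\<^bsub>Sp scale form\<^esub> g \<in> carrier (Sp scale form)"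
    by (auto simp: Sp_def intro!: bij_comp intro: Vector_Spaces.linear_compose)
qed (simp_all add: Sp_def linear_id o_assoc)

lemma (in vector_space) group_PSp: "group (PSp scale form)"
proof -
  interpret S: group "Sp scale form" by (rule group_Sp)
  show ?thesis
    unfolding PSp_def by (rule normal.factorgroup_is_group[OF S.group_center_normal])
qed

end

theory Submission
  imports Defs "HOL-Algebra.Group_Action" "HOL-Number_Theory.Euler_Criterion"
begin

text \<open>
  A Sylow \<open>p\<close>-subgroup \<open>P\<close> of the symplectic group fixes a complete isotropic flag, hence is the full
  unitriangular group of a symplectic basis \<open>b\<^sub>0, \<dots>, b\<^sub>L\<close> with \<open>L = p\<^sup>j = 2 h + 1\<close>. For \<open>a \<in> P\<close> the
  superdiagonal entries \<open>\<alpha>\<^sub>i\<close> are additive in \<open>a\<close> and satisfy \<open>\<alpha>\<^sub>2\<^sub>h\<^sub>-\<^sub>i = - \<alpha>\<^sub>i\<close>; since \<open>(a - 1)\<^sup>L\<close> has rank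
  at most one, \<open>a\<^sup>L\<close> is the transvection along \<open>b\<^sub>0\<close> with parameter
  \<open>\<alpha>\<^sub>h (\<alpha>\<^sub>0 \<cdots> \<alpha>\<^sub>h\<^sub>-\<^sub>1)\<^sup>2\<close>. Take \<open>u\<close> with \<open>\<alpha>\<^sub>0 = \<alpha>\<^sub>h = 1\<close> and \<open>\<alpha>\<^sub>i = 0\<close> for \<open>0 < i < h\<close>. Solutions of
  \<open>a\<^sup>L = (a u)\<^sup>L = g\<close> for the transvection \<open>g\<close> with parameter \<open>c\<close> carry an invariant \<open>s\<close>, which
  can be any \<open>s \<noteq> 0\<close> with \<open>s\<^sup>2 \<noteq> c\<close> and \<open>s\<^sup>2 \<noteq> - c\<close>, all values being attained equally often. As \<open>- 1\<close> is a
  square, there are fewer solutions for \<open>c = 1\<close> than for a nonsquare \<open>c\<close>; and as \<open>q\<close> is an odd power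
  of \<open>p\<close>, some natural number \<open>n\<close> is a nonsquare, so that \<open>g\<close> and \<open>g\<^sup>n\<close> differ. For \<open>PSp\<close>, the center
  has order prime to \<open>p\<close>, so the Sylow \<open>p\<close>-subgroups are isomorphic to those of \<open>Sp\<close>.
\<close>

section \<open>Finite groups\<close>

text \<open>Cauchy's theorem: Sylow's theorem with exponent 1 yields a subgroup of order
  \<open>r\<close>, hence an element of order \<open>r\<close>, and the order of an element divides
  every exponent of the group.\<close>

lemma (in group) prime_dvd_order_imp_dvd_exponent:
  assumes fin: "finite (carrier G)"
    and exp: "\<And>x. x \<in> carrier G \<Longrightarrow> x [^] (m::nat) = \<one>"
    and r: "Factorial_Ring.prime r" "r dvd order G"
  shows "r dvd m"
proof -
  obtain n where n: "order G = r * n" using r(2) by blast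
  obtain H where H: "subgroup H G" "card H = r ^ 1"
    using sylow_thm[of r G 1 n] r(1) fin n is_group by auto
  then interpret H: group "G\<lparr>carrier := H\<rparr>" by (simp add: subgroup_imp_group)
  have "r > 1" using r(1) prime_gt_1_nat by blast
  then have "H \<noteq> {\<one>}" using H(2) by auto
  then obtain x where x: "x \<in> H" "x \<noteq> \<one>"
    using subgroup.one_closed[OF H(1)] by blast
  then have xG: "x \<in> carrier G" using subgroup.mem_carrier[OF H(1)] by simp
  have "x [^] r = \<one>"
    using H.pow_order_eq_1[of x] x H(2) by (simp add: order_def flip: nat_pow_consistent)
  then have "ord x dvd r" using xG pow_eq_id by blast
  moreover have "ord x \<noteq> 1" using ord_eq_1[OF xG] x(2) by blast
  ultimately have "ord x = r" using r(1) by (metis prime_nat_iff)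
  then show ?thesis using exp[OF xG] pow_eq_id[OF xG] by blast
qed

text \<open>Every prime factor of the order divides the exponent \<open>p ^ s\<close>, so
  \<open>p\<close> is the only one.\<close>

lemma (in group) order_eq_prime_power:
  assumes fin: "finite (carrier G)" and p: "Factorial_Ring.prime p"
    and exp: "\<And>x. x \<in> carrier G \<Longrightarrow> x [^] (p ^ s :: nat) = \<one>"
  shows "\<exists>t. order G = p ^ t"
proof -
  have "order G \<noteq> 0" using order_gt_0_iff_finite fin by simp
  moreover have "\<not> is_unit p" using p by auto
  ultimately obtain y where y: "order G = p ^ multiplicity p (order G) * y" "\<not> p dvd y"
    using multiplicity_decompose'[of "order G" p] by blast
  have "y = 1"
  proof (rule ccontr)
    assume "y \<noteq> 1"
    then obtain r where r: "Factorial_Ring.prime r" "r dvd y" using prime_factor_nat by blast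
    then have "r dvd p ^ s"
      using prime_dvd_order_imp_dvd_exponent[OF fin exp] y(1) by (metis dvd_mult)
    then have "r = p" using r p by (meson prime_dvd_power primes_dvd_imp_eq)
    then show False using r y(2) by simp
  qed
  then show ?thesis using y(1) by auto
qed

text \<open>Orbits of a \<open>p\<close>-group have \<open>p\<close>-power size, so if
  \<open>x0\<close> were the only fixed point, \<open>card E\<close> would be 1 modulo
  \<open>p\<close>. With the zero vector as \<open>x0\<close> this produces nonzero fixed
  vectors.\<close>

lemma (in group_action) p_group_second_fixed_point:
  assumes p: "Factorial_Ring.prime p" and ord: "order G = p ^ t"
    and fin: "finite E" and dvd: "p dvd card E"
    and x0: "x0 \<in> E" "\<And>g. g \<in> carrier G \<Longrightarrow> \<phi> g x0 = x0"
  shows "\<exists>x\<in>E. x \<noteq> x0 \<and> (\<forall>g\<in>carrier G. \<phi> g x = x)"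
proof (rule ccontr)
  assume none: "\<not> ?thesis"
  have G: "group G" using group_hom group_hom.axioms(1) by blast
  have orb0: "orbit G \<phi> x0 = {x0}"
    using orbit_refl[OF x0(1)] x0(2) by (auto simp: orbit_def)
  have big: "p dvd card C" if C: "C \<in> orbits G E \<phi> - {{x0}}" for C
  proof -
    obtain x where x: "x \<in> E" "C = orbit G \<phi> x" using C by (auto simp: orbits_def)
    have "C \<noteq> {x}"
    proof
      assume "C = {x}"
      then have "\<forall>g\<in>carrier G. \<phi> g x = x" using x by (auto simp: orbit_def)
      then have "x = x0" using none x by blast
      then show False using C \<open>C = {x}\<close> by simp
    qed
    moreover have "x \<in> C" using x orbit_refl by blast
    ultimately have "card C \<noteq> 1" by (metis card_1_singletonE singletonD)
    moreover have "card C dvd p ^ t"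
      using orbit_stabilizer_theorem[OF x(1)] ord x(2) by (metis dvd_triv_left)
    ultimately show ?thesis
      using p by (metis divides_primepow_nat dvd_power gr0I power_0)
  qed
  have finO: "finite (orbits G E \<phi>)"
    using orbits_coverture fin by (metis finite_UnionD)
  have O0: "{x0} \<in> orbits G E \<phi>" using orb0 x0(1) by (auto simp: orbits_def)
  have "card E = (\<Sum>C\<in>orbits G E \<phi>. card C)"
    using disjoint_sum[OF fin, of "\<lambda>_. 1::nat"] by simp
  also have "\<dots> = 1 + (\<Sum>C\<in>orbits G E \<phi> - {{x0}}. card C)"
    using sum.remove[OF finO O0, of card] by simp
  finally have "p dvd 1 + (\<Sum>C\<in>orbits G E \<phi> - {{x0}}. card C)" using dvd by simp
  moreover have "p dvd (\<Sum>C\<in>orbits G E \<phi> - {{x0}}. card C)"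
    by (rule dvd_sum) (rule big)
  ultimately have "p dvd 1" by (meson dvd_add_left_iff)
  then show False using p by auto
qed

lemma FSZ_iso:
  assumes G: "group G" and H: "group H" and f: "f \<in> iso G H" and FSZ: "FSZ m H"
  shows "FSZ m G"
proof -
  interpret group_hom G H f
    using assms by (auto simp: group_hom_def group_hom_axioms_def iso_def)
  have bij: "bij_betw f (carrier G) (carrier H)" using f by (auto simp: iso_def)
  have ord: "order G = order H" unfolding order_def by (rule bij_betw_same_card[OF bij])
  have eq_iff: "f x = f y \<longleftrightarrow> x = y" if "x \<in> carrier G" "y \<in> carrier G" for x y
    using bij that by (meson bij_betw_def inj_on_eq_iff)
  have card: "card (FSZ_set G m u g) = card (FSZ_set H m (f u) (f g))"
    if "u \<in> carrier G" "g \<in> carrier G" for u g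
  proof (rule bij_betw_same_card)
    have mem: "f a \<in> FSZ_set H m (f u) (f g) \<longleftrightarrow> a \<in> FSZ_set G m u g" if a: "a \<in> carrier G" for a
      using a \<open>u \<in> carrier G\<close> \<open>g \<in> carrier G\<close> eq_iff[of "a [^]\<^bsub>G\<^esub> m" g]
        eq_iff[of "(a \<otimes>\<^bsub>G\<^esub> u) [^]\<^bsub>G\<^esub> m" g]
      by (simp add: FSZ_set_def hom_nat_pow)
    have "f ` FSZ_set G m u g = FSZ_set H m (f u) (f g)"
    proof
      show "f ` FSZ_set G m u g \<subseteq> FSZ_set H m (f u) (f g)"
        using mem by (auto simp: FSZ_set_def)
      show "FSZ_set H m (f u) (f g) \<subseteq> f ` FSZ_set G m u g"
      proof
        fix b assume b: "b \<in> FSZ_set H m (f u) (f g)"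
        then have "b \<in> carrier H" by (simp add: FSZ_set_def)
        then obtain a where "a \<in> carrier G" "b = f a"
          using bij by (auto simp: bij_betw_def)
        then show "b \<in> f ` FSZ_set G m u g" using mem b by blast
      qed
    qed
    moreover have "inj_on f (FSZ_set G m u g)"
      using bij by (auto simp: bij_betw_def FSZ_set_def intro: inj_on_subset)
    ultimately show "bij_betw f (FSZ_set G m u g) (FSZ_set H m (f u) (f g))"
      by (simp add: bij_betw_def)
  qed
  show ?thesis
    unfolding FSZ_def
    using FSZ by (auto simp: card ord FSZ_def hom_nat_pow)
qed

text \<open>The preimage \<open>H\<close> of \<open>Q\<close> has order
  \<open>card Q * card N\<close>, so it contains a subgroup \<open>P\<close> of order
  \<open>card Q\<close>. As \<open>P\<close> meets \<open>N\<close> trivially, the quotient map is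
  injective on \<open>P\<close>, and by counting its image is all of \<open>Q\<close>.\<close>

lemma (in group) sylow_subgroup_FactGroup_iso:
  assumes fin: "finite (carrier G)" and p: "Factorial_Ring.prime p"
    and N: "N \<lhd> G" and pN: "\<not> p dvd card N"
    and Q: "sylow_subgroup p (G Mod N) Q"
  shows "\<exists>P. sylow_subgroup p G P \<and>
    (\<lambda>x. N #> x) \<in> iso (G\<lparr>carrier := P\<rparr>) ((G Mod N)\<lparr>carrier := Q\<rparr>)"
proof -
  interpret N: normal N G by (rule N)
  interpret M: group "G Mod N" by (rule N.factorgroup_is_group)
  define q where "q = p ^ multiplicity p (order G)"
  have subN: "subgroup N G" by (rule N.subgroup_axioms)
  have ordG: "order G = card N * order (G Mod N)"
    using lagrange[OF subN] by (simp add: order_def FactGroup_def mult.commute)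
  have "order G \<noteq> 0" using order_gt_0_iff_finite fin by simp
  then have "multiplicity p (order G) = multiplicity p (order (G Mod N))"
    using pN p by (simp add: ordG prime_elem_multiplicity_mult_distrib not_dvd_imp_multiplicity_0)
  then have cardQ: "card Q = q" and subQ: "subgroup Q (G Mod N)"
    using Q by (simp_all add: sylow_subgroup_def q_def)
  have QR: "Q \<subseteq> rcosets N" using subgroup.subset[OF subQ] by (simp add: FactGroup_def)
  define H where "H = {x \<in> carrier G. N #> x \<in> Q}"
  have mod_hom: "group_hom G (G Mod N) (\<lambda>x. N #> x)"
    using N.r_coset_hom_Mod by (simp add: group_hom_def group_hom_axioms_def M.is_group is_group)
  interpret \<pi>: group_hom G "G Mod N" "\<lambda>x. N #> x" by (rule mod_hom)
  have subH: "subgroup H G"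
  proof (rule subgroupI)
    show "H \<subseteq> carrier G" by (auto simp: H_def)
    show "H \<noteq> {}" using subgroup.one_closed[OF subQ] \<pi>.hom_one by (auto simp: H_def)
  next
    fix a assume "a \<in> H"
    then show "inv a \<in> H" using subgroup.m_inv_closed[OF subQ] \<pi>.hom_inv by (auto simp: H_def)
  next
    fix a b assume "a \<in> H" "b \<in> H"
    then show "a \<otimes> b \<in> H" using subgroup.m_closed[OF subQ] \<pi>.hom_mult by (auto simp: H_def)
  qed
  \<comment> \<open>Writing \<open>H\<close> as the disjoint union of the cosets in \<open>Q\<close>
    gives its order.\<close>
  have "H = \<Union>Q"
  proof
    show "H \<subseteq> \<Union>Q" using rcos_self[OF _ subN] by (auto simp: H_def)
    show "\<Union>Q \<subseteq> H"
    proof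
      fix x assume "x \<in> \<Union>Q"
      then obtain C where C: "C \<in> Q" "x \<in> C" by blast
      then obtain y where y: "y \<in> carrier G" "C = N #> y" using QR by (auto simp: RCOSETS_def)
      have "x \<in> carrier G" using C y subN r_coset_subset_G subgroup.subset by blast
      moreover have "N #> x = C" using repr_independence C y subN by metis
      ultimately show "x \<in> H" using C by (simp add: H_def)
    qed
  qed
  moreover have "card N * card Q = card (\<Union>Q)"
  proof (rule card_partition)
    show "finite (\<Union>Q)" using \<open>H = \<Union>Q\<close> fin by (auto simp: H_def intro: finite_subset)
    then show "finite Q" by (rule finite_UnionD)
    show "card C = card N" if "C \<in> Q" for C
      using that QR card_rcosets_equal[OF _ N.subset] by auto
    show "C \<inter> D = {}" if "C \<in> Q" "D \<in> Q" "C \<noteq> D" for C D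
      using that QR rcos_disjoint[OF subN] by (auto simp: pairwise_def disjnt_def)
  qed
  ultimately have cardH: "card H = q * card N" using cardQ by (simp add: mult.commute)
  interpret H: group "G\<lparr>carrier := H\<rparr>" using subH by (simp add: subgroup_imp_group)
  obtain P where P: "subgroup P (G\<lparr>carrier := H\<rparr>)" "card P = q"
    using sylow_thm[of p "G\<lparr>carrier := H\<rparr>" "multiplicity p (order G)" "card N"]
      p H.is_group cardH fin finite_subset[of H "carrier G"]
    by (auto simp: order_def q_def H_def)
  have subP: "subgroup P G" using P(1) subH incl_subgroup by blast
  have PH: "P \<subseteq> H" using subgroup.subset[OF P(1)] by simp
  interpret P: group "G\<lparr>carrier := P\<rparr>" using subP by (simp add: subgroup_imp_group)
  \<comment> \<open>The order of such an element divides the coprime numbers \<open>q\<close> and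
    \<open>card N\<close>.\<close>
  have triv: "x = \<one>" if "x \<in> P" "x \<in> N" for x
  proof -
    have xG: "x \<in> carrier G" using that(1) subgroup.mem_carrier[OF subP] by blast
    have "x [^] q = \<one>"
      using P.pow_order_eq_1[of x] that P(2) by (simp add: order_def flip: nat_pow_consistent)
    moreover have "x [^] card N = \<one>"
      using group.pow_order_eq_1[OF subgroup_imp_group[OF subN], of x] that
      by (simp add: order_def flip: nat_pow_consistent)
    ultimately have "ord x dvd q" "ord x dvd card N" using pow_eq_id[OF xG] by blast+
    moreover have "coprime q (card N)"
      using p pN by (simp add: q_def prime_imp_coprime)
    ultimately have "ord x = 1" by (meson coprime_common_divisor nat_dvd_1_iff_1)
    then show ?thesis using ord_eq_1[OF xG] by blast
  qed
  have inj: "inj_on (\<lambda>x. N #> x) P"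
  proof (rule inj_onI)
    fix x y assume xy: "x \<in> P" "y \<in> P" "N #> x = N #> y"
    have G: "x \<in> carrier G" "y \<in> carrier G" using xy subgroup.mem_carrier[OF subP] by blast+
    have "x \<in> N #> y" using rcos_self[OF G(1) subN] xy(3) by simp
    then have "x \<otimes> inv y \<in> N" by (rule N.rcos_module_imp[OF is_group G(2)])
    moreover have "x \<otimes> inv y \<in> P"
      using xy subgroup.m_closed[OF subP] subgroup.m_inv_closed[OF subP] by blast
    ultimately have "x \<otimes> inv y = \<one>" using triv by blast
    then show "x = y" using G inv_equality inv_inv by fastforce
  qed
  have sub: "(\<lambda>x. N #> x) ` P \<subseteq> Q" using PH by (auto simp: H_def)
  have "finite Q" using cardQ p by (intro card_ge_0_finite) (simp add: q_def prime_gt_0_nat)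
  then have "(\<lambda>x. N #> x) ` P = Q"
    using sub inj P(2) cardQ by (metis card_image card_subset_eq)
  then have "(\<lambda>x. N #> x) \<in> iso (G\<lparr>carrier := P\<rparr>) ((G Mod N)\<lparr>carrier := Q\<rparr>)"
    using inj subgroup.mem_carrier[OF subP] \<pi>.hom_mult
    by (auto simp: iso_def hom_def bij_betw_def)
  moreover have "sylow_subgroup p G P" using subP P(2) by (simp add: sylow_subgroup_def q_def)
  ultimately show ?thesis by blast
qed

section \<open>Unipotent operators in characteristic p\<close>

context vector_space
begin

text \<open>The binomial theorem for \<open>f = 1 + N\<close>, where \<open>N\<close> commutes with
  the identity.\<close>

lemma funpow_binomial:
  assumes f: "Vector_Spaces.linear scale scale f"
  shows "(f ^^ n) v = (\<Sum>k\<le>n. scale (of_nat (n choose k)) (((\<lambda>w. f w - w) ^^ k) v))"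
proof (induction n)
  case 0
  show ?case by simp
next
  case (Suc n)
  interpret f: Vector_Spaces.linear scale scale f by (fact f)
  define N where "N = (\<lambda>w. f w - w)"
  have "(f ^^ Suc n) v = f (\<Sum>k\<le>n. scale (of_nat (n choose k)) ((N ^^ k) v))"
    using Suc by (simp add: N_def)
  also have "\<dots> = (\<Sum>k\<le>n. scale (of_nat (n choose k)) ((N ^^ k) v + (N ^^ Suc k) v))"
    by (simp add: f.sum f.scale N_def)
  also have "\<dots> = (\<Sum>k\<le>n. scale (of_nat (n choose k)) ((N ^^ k) v)) +
      (\<Sum>k\<le>n. scale (of_nat (n choose k)) ((N ^^ Suc k) v))"
    by (simp only: scale_right_distrib sum.distrib)
  \<comment> \<open>The added term is zero; it makes the sum, once its index is shifted, match the
    other one for Pascal's rule.\<close>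
  also have "(\<Sum>k\<le>n. scale (of_nat (n choose k)) ((N ^^ k) v)) =
      (\<Sum>k\<le>Suc n. scale (of_nat (n choose k)) ((N ^^ k) v))"
    by (simp add: binomial_eq_0)
  also have "\<dots> = v + (\<Sum>k\<le>n. scale (of_nat (n choose Suc k)) ((N ^^ Suc k) v))"
    by (subst sum.atMost_Suc_shift) simp
  also have "v + (\<Sum>k\<le>n. scale (of_nat (n choose Suc k)) ((N ^^ Suc k) v)) +
        (\<Sum>k\<le>n. scale (of_nat (n choose k)) ((N ^^ Suc k) v)) =
      v + (\<Sum>k\<le>n. scale (of_nat (Suc n choose Suc k)) ((N ^^ Suc k) v))"
    by (simp add: sum.distrib scale_left_distrib add.commute add.assoc)
  also have "\<dots> = (\<Sum>k\<le>Suc n. scale (of_nat (Suc n choose k)) ((N ^^ k) v))"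
    by (subst sum.atMost_Suc_shift) simp
  finally show ?case by (simp add: N_def)
qed

lemma linear_funpow:
  assumes "Vector_Spaces.linear scale scale f"
  shows "Vector_Spaces.linear scale scale (f ^^ n)"
proof (induction n)
  case 0
  show ?case using linear_id by (simp add: id_def)
next
  case (Suc n)
  show ?case unfolding funpow.simps by (rule Vector_Spaces.linear_compose[OF Suc assms])
qed

text \<open>All binomial coefficients strictly between the ends are divisible by
  \<open>p\<close>.\<close>

lemma funpow_prime:
  assumes f: "Vector_Spaces.linear scale scale f"
    and p: "Factorial_Ring.prime p" and char: "of_nat p = (0 :: 'a)"
  shows "(f ^^ p) v = v + ((\<lambda>w. f w - w) ^^ p) v"
proof -
  define g where "g k = scale (of_nat (p choose k)) (((\<lambda>w. f w - w) ^^ k) v)" for k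
  have p1: "p > 1" using p prime_gt_1_nat by blast
  have "g k = 0" if "0 < k" "k < p" for k
  proof -
    have "p dvd (p choose k)" using that p by (intro dvd_choose_prime) auto
    then obtain c where "p choose k = p * c" by blast
    then show ?thesis using char by (simp add: g_def)
  qed
  then have "sum g {..p} = sum g {0, p}"
    by (intro sum.mono_neutral_right) auto
  also have "\<dots> = v + ((\<lambda>w. f w - w) ^^ p) v" using p1 by (simp add: g_def)
  finally show ?thesis using funpow_binomial[OF f, of p v] by (simp add: g_def)
qed

text \<open>By induction \<open>f ^^ (p ^ j)\<close> differs from the identity by the
  \<open>p ^ j\<close>-th power of \<open>f - 1\<close>, so \<open>funpow_prime\<close> applies to
  it again.\<close>

lemma funpow_prime_power:
  assumes f: "Vector_Spaces.linear scale scale f"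
    and p: "Factorial_Ring.prime p" and char: "of_nat p = (0 :: 'a)"
  shows "(f ^^ (p ^ j)) v = v + ((\<lambda>w. f w - w) ^^ (p ^ j)) v"
proof (induction j arbitrary: v)
  case 0
  show ?case by simp
next
  case (Suc j)
  have "(\<lambda>w. (f ^^ (p ^ j)) w - w) = (\<lambda>w. f w - w) ^^ (p ^ j)"
    using Suc by (simp add: fun_eq_iff)
  then have "((f ^^ (p ^ j)) ^^ p) v = v + (((\<lambda>w. f w - w) ^^ (p ^ j)) ^^ p) v"
    using funpow_prime[OF linear_funpow[OF f] p char, of "p ^ j" v] by simp
  then show ?case by (simp add: funpow_mult mult.commute)
qed

end

section \<open>Symplectic forms\<close>

context symplectic_space
begin

lemma form_add_left: "form (x + y) z = form x z + form y z"
proof -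
  interpret l: Vector_Spaces.linear scale "(*)" "\<lambda>x. form x z" by (rule linear_left)
  show ?thesis by (rule l.add)
qed

lemma form_scale_left: "form (scale c x) z = c * form x z"
proof -
  interpret l: Vector_Spaces.linear scale "(*)" "\<lambda>x. form x z" by (rule linear_left)
  show ?thesis by (rule l.scale)
qed

lemma form_add_right: "form z (x + y) = form z x + form z y"
proof -
  interpret l: Vector_Spaces.linear scale "(*)" "form z" using linear_right[of z] by simp
  show ?thesis by (rule l.add)
qed

lemma form_scale_right: "form z (scale c x) = c * form z x"
proof -
  interpret l: Vector_Spaces.linear scale "(*)" "form z" using linear_right[of z] by simp
  show ?thesis by (rule l.scale)
qed

lemma form_zero_left [simp]: "form 0 z = 0"
  using form_scale_left[of 0 0 z] by simp

lemma form_zero_right [simp]: "form z 0 = 0"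
  using form_scale_right[of z 0 0] by simp

lemma form_minus_left: "form (- x) z = - form x z"
  using form_add_left[of x "- x" z] by (simp add: eq_neg_iff_add_eq_0 add.commute)

lemma form_minus_right: "form z (- x) = - form z x"
  using form_add_right[of z x "- x"] by (simp add: eq_neg_iff_add_eq_0 add.commute)

lemma form_diff_left: "form (x - y) z = form x z - form y z"
  using form_add_left[of x "- y" z] by (simp add: form_minus_left)

lemma form_diff_right: "form z (x - y) = form z x - form z y"
  using form_add_right[of z x "- y"] by (simp add: form_minus_right)

lemma form_sum_left: "form (sum f A) z = (\<Sum>i\<in>A. form (f i) z)"
  by (induction A rule: infinite_finite_induct) (auto simp: form_add_left)

lemma form_sum_right: "form z (sum f A) = (\<Sum>i\<in>A. form z (f i))"
  by (induction A rule: infinite_finite_induct) (auto simp: form_add_right)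

lemmas form_simps =
  form_add_left form_add_right form_scale_left form_scale_right
  form_diff_left form_diff_right form_sum_left form_sum_right

lemma form_skew: "form x y = - form y x"
proof -
  have "form (x + y) (x + y) = form x y + form y x"
    unfolding form_add_left form_add_right by (simp add: alternating)
  then show ?thesis using alternating[of "x + y"] eq_neg_iff_add_eq_0 by metis
qed

section \<open>Isometries as elements of the symplectic group\<close>

lemma carrier_Sp_iff:
  "f \<in> carrier (Sp scale form) \<longleftrightarrow>
    Vector_Spaces.linear scale scale f \<and> bij f \<and> (\<forall>x y. form (f x) (f y) = form x y)"
  by (simp add: Sp_def)

lemma mult_Sp: "a \<otimes>\<^bsub>Sp scale form\<^esub> b = a \<circ> b"
  and one_Sp: "\<one>\<^bsub>Sp scale form\<^esub> = id"
  by (simp_all add: Sp_def)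

lemma pow_Sp: "a [^]\<^bsub>Sp scale form\<^esub> (n::nat) = a ^^ n"
proof (induction n)
  case 0
  show ?case by (simp add: one_Sp nat_pow_def id_def)
next
  case (Suc n)
  have "a [^]\<^bsub>Sp scale form\<^esub> Suc n = a [^]\<^bsub>Sp scale form\<^esub> n \<otimes>\<^bsub>Sp scale form\<^esub> a"
    by (simp add: nat_pow_def)
  then show ?case using Suc by (simp add: mult_Sp funpow_Suc_right del: funpow.simps)
qed

lemma Sp_add: "f \<in> carrier (Sp scale form) \<Longrightarrow> f (x + y) = f x + f y"
  and Sp_scale: "f \<in> carrier (Sp scale form) \<Longrightarrow> f (scale c x) = scale c (f x)"
  and Sp_form: "f \<in> carrier (Sp scale form) \<Longrightarrow> form (f x) (f y) = form x y"
  by (auto simp: carrier_Sp_iff Vector_Spaces.linear_iff)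

lemma Sp_diff: "f \<in> carrier (Sp scale form) \<Longrightarrow> f (x - y) = f x - f y"
  using Sp_add[of f "x - y" y] by (simp add: algebra_simps)

lemma Sp_zero: "f \<in> carrier (Sp scale form) \<Longrightarrow> f 0 = 0"
  using Sp_diff[of f 0 0] by simp

lemma Sp_sum: "f \<in> carrier (Sp scale form) \<Longrightarrow> f (sum g A) = (\<Sum>i\<in>A. f (g i))"
  by (induction A rule: infinite_finite_induct) (auto simp: Sp_add Sp_zero)

lemma Sp_adjoint:
  assumes "f \<in> carrier (Sp scale form)"
  shows "form (f x) y = form x ((inv\<^bsub>Sp scale form\<^esub> f) y)"
proof -
  interpret group "Sp scale form" by (rule group_Sp)
  have "(f \<circ> inv\<^bsub>Sp scale form\<^esub> f) y = y"
    using r_inv[OF assms] by (simp add: mult_Sp one_Sp)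
  then show ?thesis using Sp_form[OF assms, of x "(inv\<^bsub>Sp scale form\<^esub> f) y"] by simp
qed

text \<open>Nondegeneracy makes a form-preserving map injective, and finiteness then makes it
  bijective.\<close>

lemma form_preserving_in_Sp:
  assumes fin: "finite (UNIV :: 'v set)"
    and add: "\<And>x y. f (x + y) = f x + f y" and scale: "\<And>c x. f (scale c x) = scale c (f x)"
    and form: "\<And>x y. form (f x) (f y) = form x y"
  shows "f \<in> carrier (Sp scale form)"
proof -
  have "inj f"
  proof (rule injI)
    fix x y assume "f x = f y"
    then have "form (x - y) z = 0" for z
      using form[of x z] form[of y z] by (simp add: form_diff_left)
    then show "x = y" using nondegenerate[of "x - y"] by simp
  qed
  then have "bij f" using finite_UNIV_inj_surj[OF fin] by (simp add: bij_def)
  moreover have "Vector_Spaces.linear scale scale f"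
    using add scale by (simp add: Vector_Spaces.linear_iff vector_space_axioms)
  ultimately show ?thesis using form by (simp add: carrier_Sp_iff)
qed

lemma transvection_in_Sp:
  assumes "finite (UNIV :: 'v set)"
  shows "(\<lambda>v. v + scale (c * form v w) w) \<in> carrier (Sp scale form)"
  using assms
proof (rule form_preserving_in_Sp)
  show "form (x + scale (c * form x w) w) (y + scale (c * form y w) w) = form x y" for x y
    using form_skew[of w y] by (simp add: form_simps alternating algebra_simps)
qed (simp_all add: form_simps algebra_simps scale_right_distrib scale_left_distrib)

lemma finite_carrier_Sp:
  assumes "finite (UNIV :: 'v set)"
  shows "finite (carrier (Sp scale form))"
proof -
  have "finite (\<Pi>\<^sub>E x\<in>(UNIV :: 'v set). (UNIV :: 'v set))" using assms by (intro finite_PiE)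
  then show ?thesis by (rule finite_subset[rotated]) simp
qed

text \<open>A central \<open>z\<close> commutes with all transvections, so it maps each vector
  \<open>v\<close> to a multiple of \<open>v\<close>; since it preserves the form, the factor
  squares to 1. Hence the center has exponent dividing 2.\<close>

lemma center_Sp_square:
  assumes fin: "finite (UNIV :: 'v set)" and z: "z \<in> group_center (Sp scale form)"
  shows "z \<circ> z = id"
proof -
  have zS: "z \<in> carrier (Sp scale form)"
    and comm: "\<And>a. a \<in> carrier (Sp scale form) \<Longrightarrow> z \<circ> a = a \<circ> z"
    using z by (auto simp: group_center_def mult_Sp)
  \<comment> \<open>Compares both orders of applying \<open>z\<close> and the transvection along
    \<open>v\<close>, evaluated at \<open>w\<close>.\<close>
  have key: "scale (form w v) (z v) = scale (form (z w) v) v" for v w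
  proof -
    have "z (w + scale (1 * form w v) v) = z w + scale (1 * form (z w) v) v"
      using comm[OF transvection_in_Sp[OF fin, of 1 v]] by (simp add: fun_eq_iff)
    then show ?thesis by (simp add: Sp_add[OF zS] Sp_scale[OF zS])
  qed
  have "z (z v) = v" for v
  proof (cases "v = 0")
    case True
    then show ?thesis by (simp add: Sp_zero[OF zS])
  next
    case False
    then obtain w where "form v w \<noteq> 0" using nondegenerate by blast
    then have w: "form w v \<noteq> 0" using form_skew[of w v] by simp
    define l where "l = form (z w) v / form w v"
    have "scale (1 / form w v) (scale (form w v) (z v)) = scale (1 / form w v) (scale (form (z w) v) v)"
      using key by simp
    then have zv: "z v = scale l v" using w by (simp add: l_def)
    have "form w v = form (z w) (z v)" using Sp_form[OF zS] by simp
    also have "\<dots> = l * (l * form w v)" using w by (simp add: zv form_scale_right l_def)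
    finally have "l * l = 1" using w by simp
    then show ?thesis by (simp add: zv Sp_scale[OF zS])
  qed
  then show ?thesis by (simp add: fun_eq_iff)
qed

end

section \<open>The unipotent group of a symplectic basis\<close>

text \<open>Closure under inverses is automatic, because the inverse of \<open>a\<close> is
  \<open>a\<close> to the power \<open>order G - 1\<close>.\<close>

lemma (in group) subgroup_of_finite:
  assumes fin: "finite (carrier G)" and sub: "H \<subseteq> carrier G" and one: "\<one> \<in> H"
    and mult: "\<And>x y. x \<in> H \<Longrightarrow> y \<in> H \<Longrightarrow> x \<otimes> y \<in> H"
  shows "subgroup H G"
proof (rule subgroupI)
  show "H \<subseteq> carrier G" "H \<noteq> {}" using sub one by auto
  fix a assume a: "a \<in> H"
  have pow: "a [^] n \<in> H" for n :: nat
    by (induction n) (use a one mult in auto)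
  have aG: "a \<in> carrier G" using a sub by blast
  have "order G > 0" using order_gt_0_iff_finite fin by blast
  then have "a [^] (order G - 1) \<otimes> a = \<one>"
    using pow_order_eq_1[OF aG] nat_pow_Suc[of a "order G - 1"] by simp
  then have "inv a = a [^] (order G - 1)" using aG by (simp add: inv_equality)
  then show "inv a \<in> H" using pow by simp
qed (use mult in auto)

text \<open>The form is antidiagonal, so the span of the first \<open>d\<close> basis vectors is
  orthogonal to the span of the first \<open>2 * h + 2 - d\<close>: the initial spans form a
  self-dual flag. \<open>separating\<close> stands in for the spanning property.\<close>

locale symplectic_basis = symplectic_space scale form
  for scale :: "'f::field \<Rightarrow> 'v::ab_group_add \<Rightarrow> 'v" and form :: "'v \<Rightarrow> 'v \<Rightarrow> 'f" +
  fixes h :: nat and b :: "nat \<Rightarrow> 'v"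
  assumes finite_UNIV: "finite (UNIV :: 'v set)"
    and form_b: "\<And>i j. i \<le> 2 * h + 1 \<Longrightarrow> j \<le> 2 * h + 1 \<Longrightarrow>
      form (b i) (b j) = (if i + j = 2 * h + 1 then if i < j then 1 else - 1 else 0)"
    and separating: "\<And>v. (\<And>i. i \<le> 2 * h + 1 \<Longrightarrow> form v (b i) = 0) \<Longrightarrow> v = 0"
begin

text \<open>The coordinate of \<open>v\<close> at \<open>b i\<close>, read off by pairing with the
  dual basis vector; the sign compensates that of \<open>form_b\<close>.\<close>

definition coef :: "nat \<Rightarrow> 'v \<Rightarrow> 'f" where
  "coef i v = (if i \<le> h then 1 else - 1) * form v (b (2 * h + 1 - i))"

lemma coef_add [simp]: "coef i (v + w) = coef i v + coef i w"
  and coef_diff [simp]: "coef i (v - w) = coef i v - coef i w"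
  and coef_scale [simp]: "coef i (scale c v) = c * coef i v"
  and coef_zero [simp]: "coef i 0 = 0"
  by (simp_all add: coef_def form_simps)

lemma coef_sum: "coef i (sum f A) = (\<Sum>x\<in>A. coef i (f x))"
  by (induction A rule: infinite_finite_induct) auto

lemma coef_b: "i \<le> 2 * h + 1 \<Longrightarrow> k \<le> 2 * h + 1 \<Longrightarrow> coef k (b i) = (if k = i then 1 else 0)"
  by (auto simp: coef_def form_b)

lemma form_eq_coef:
  assumes "i \<le> 2 * h + 1"
  shows "form v (b i) = (if i \<le> h then - 1 else 1) * coef (2 * h + 1 - i) v"
  using assms by (auto simp: coef_def)

lemma eq_zero_if_coef: "(\<And>k. k \<le> 2 * h + 1 \<Longrightarrow> coef k v = 0) \<Longrightarrow> v = 0"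
  by (rule separating) (simp add: form_eq_coef)

lemma eq_if_coef: "(\<And>k. k \<le> 2 * h + 1 \<Longrightarrow> coef k v = coef k w) \<Longrightarrow> v = w"
  using eq_zero_if_coef[of "v - w"] by simp

lemma expand: "v = (\<Sum>i\<le>2 * h + 1. scale (coef i v) (b i))"
proof (rule eq_if_coef)
  fix k assume k: "k \<le> 2 * h + 1"
  have "coef k (\<Sum>i\<le>2 * h + 1. scale (coef i v) (b i)) =
      (\<Sum>i\<le>2 * h + 1. if i = k then coef i v else 0)"
    unfolding coef_sum using k by (intro sum.cong) (auto simp: coef_b)
  then show "coef k v = coef k (\<Sum>i\<le>2 * h + 1. scale (coef i v) (b i))"
    using k by simp
qed

text \<open>The span of the first \<open>d\<close> basis vectors.\<close>

definition fil :: "nat \<Rightarrow> 'v set" where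
  "fil d = {v. \<forall>k \<le> 2 * h + 1. d \<le> k \<longrightarrow> coef k v = 0}"

lemma fil_add: "v \<in> fil d \<Longrightarrow> w \<in> fil d \<Longrightarrow> v + w \<in> fil d"
  and fil_scale: "v \<in> fil d \<Longrightarrow> scale c v \<in> fil d"
  and zero_in_fil: "0 \<in> fil d"
  and fil_mono: "v \<in> fil d \<Longrightarrow> d \<le> d' \<Longrightarrow> v \<in> fil d'"
  and fil_0: "v \<in> fil 0 \<Longrightarrow> v = 0"
  and fil_top: "2 * h + 2 \<le> d \<Longrightarrow> v \<in> fil d"
  and fil_coef: "v \<in> fil d \<Longrightarrow> d \<le> k \<Longrightarrow> k \<le> 2 * h + 1 \<Longrightarrow> coef k v = 0"
  by (auto simp: fil_def intro: eq_zero_if_coef)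

lemma fil_sum: "(\<And>x. x \<in> A \<Longrightarrow> f x \<in> fil d) \<Longrightarrow> sum f A \<in> fil d"
  by (induction A rule: infinite_finite_induct) (auto intro: fil_add zero_in_fil)

lemma b_in_fil: "i < d \<Longrightarrow> i \<le> 2 * h + 1 \<Longrightarrow> b i \<in> fil d"
  by (auto simp: fil_def coef_b)

text \<open>The isometries acting trivially on the successive quotients of the flag, that is, the
  unitriangular ones.\<close>

definition unip :: "('v \<Rightarrow> 'v) set" where
  "unip = {a \<in> carrier (Sp scale form). \<forall>d. \<forall>v \<in> fil (Suc d). a v - v \<in> fil d}"

lemma unip_Sp: "a \<in> unip \<Longrightarrow> a \<in> carrier (Sp scale form)"
  by (simp add: unip_def)

lemma unip_fil: "a \<in> unip \<Longrightarrow> v \<in> fil (Suc d) \<Longrightarrow> a v - v \<in> fil d"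
  by (simp add: unip_def)

lemma unip_fil_closed: "a \<in> unip \<Longrightarrow> v \<in> fil d \<Longrightarrow> a v \<in> fil d"
  using fil_add[OF fil_mono[OF unip_fil[of a v "d - 1"]], of d v]
  by (cases d) (auto dest: fil_0 simp: unip_def Sp_zero zero_in_fil)

text \<open>By linearity \<open>a v - v\<close> is a combination of the vectors
  \<open>a (b i) - b i\<close>, and for \<open>v\<close> in \<open>fil (Suc d)\<close> only those
  with \<open>i \<le> d\<close> contribute.\<close>

lemma unipI:
  assumes a: "a \<in> carrier (Sp scale form)"
    and b: "\<And>i. i \<le> 2 * h + 1 \<Longrightarrow> a (b i) - b i \<in> fil i"
  shows "a \<in> unip"
proof -
  have "a v - v \<in> fil d" if v: "v \<in> fil (Suc d)" for v d
  proof -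
    have "a v - v = (\<Sum>i\<le>2 * h + 1. scale (coef i v) (a (b i) - b i))"
    proof -
      have "a v = (\<Sum>i\<le>2 * h + 1. scale (coef i v) (a (b i)))"
        by (rule trans[OF arg_cong[OF expand, of a]]) (simp only: Sp_sum[OF a] Sp_scale[OF a])
      then have "a v - v = (\<Sum>i\<le>2 * h + 1. scale (coef i v) (a (b i))) -
          (\<Sum>i\<le>2 * h + 1. scale (coef i v) (b i))"
        by (rule arg_cong2[OF _ expand])
      then show ?thesis by (simp only: scale_right_diff_distrib sum_subtractf)
    qed
    also have "\<dots> \<in> fil d"
    proof (rule fil_sum)
      fix i assume i: "i \<in> {..2 * h + 1}"
      show "scale (coef i v) (a (b i) - b i) \<in> fil d"
      proof (cases "i \<le> d")
        case True
        then show ?thesis using b[of i] i by (auto intro: fil_scale fil_mono)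
      next
        case False
        then have "coef i v = 0" using v i by (auto intro: fil_coef)
        then show ?thesis by (simp add: zero_in_fil)
      qed
    qed
    finally show ?thesis .
  qed
  then show ?thesis using a by (simp add: unip_def)
qed

lemma id_in_unip: "id \<in> unip"
  using monoid.one_closed[OF group.is_monoid[OF group_Sp[of form]]]
  by (auto simp: unip_def one_Sp zero_in_fil)

lemma comp_in_unip:
  assumes a: "a \<in> unip" and c: "c \<in> unip"
  shows "a \<circ> c \<in> unip"
proof -
  interpret group "Sp scale form" by (rule group_Sp)
  have "a (c v) - v \<in> fil d" if v: "v \<in> fil (Suc d)" for v d
    using fil_add[OF unip_fil[OF a unip_fil_closed[OF c v]] unip_fil[OF c v]] by simp
  then show ?thesis
    using m_closed[OF unip_Sp[OF a] unip_Sp[OF c]] by (simp add: unip_def mult_Sp)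
qed

lemma subgroup_unip: "subgroup unip (Sp scale form)"
  by (rule group.subgroup_of_finite[OF group_Sp finite_carrier_Sp[OF finite_UNIV]])
    (auto simp: one_Sp mult_Sp id_in_unip unip_Sp comp_in_unip)

section \<open>Superdiagonal entries of unitriangular isometries\<close>

definition alpha :: "nat \<Rightarrow> ('v \<Rightarrow> 'v) \<Rightarrow> 'f" where
  "alpha i a = coef i (a (b (Suc i)))"

text \<open>\<open>a - 1\<close> lowers the flag by one step and acts on leading coordinates as
  multiplication by \<open>alpha i a\<close>; the part \<open>w\<close> of \<open>v\<close> below
  the leading term drops further and contributes nothing.\<close>

lemma coef_unip_diff:
  assumes a: "a \<in> unip" and i: "i < 2 * h + 1" and v: "v \<in> fil (Suc (Suc i))"
  shows "coef i (a v - v) = coef (Suc i) v * alpha i a"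
proof -
  define c where "c = coef (Suc i) v"
  define w where "w = v - scale c (b (Suc i))"
  have "w \<in> fil (Suc i)"
    using v i by (auto simp: w_def c_def fil_def coef_b)
  then have "coef i (a w - w) = 0" using unip_fil[OF a] i by (intro fil_coef[of _ i]) auto
  moreover have "a v - v = (a w - w) + scale c (a (b (Suc i)) - b (Suc i))"
    using unip_Sp[OF a] by (simp add: w_def Sp_diff Sp_scale scale_right_diff_distrib)
  ultimately show ?thesis using i by (simp add: alpha_def c_def coef_b)
qed

lemma alpha_comp:
  assumes a: "a \<in> unip" and c: "c \<in> unip" and i: "i < 2 * h + 1"
  shows "alpha i (a \<circ> c) = alpha i a + alpha i c"
proof -
  let ?v = "b (Suc i)"
  have v: "?v \<in> fil (Suc (Suc i))" using i by (simp add: b_in_fil)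
  have "coef (Suc i) (c ?v - ?v) = 0"
    using unip_fil[OF c v] i by (intro fil_coef) auto
  then have "coef (Suc i) (c ?v) = 1" using i by (simp add: coef_b)
  then have "coef i (a (c ?v) - c ?v) = alpha i a"
    using coef_unip_diff[OF a i unip_fil_closed[OF c v]] by simp
  then show ?thesis by (simp add: alpha_def algebra_simps)
qed

text \<open>Invariance of the form on \<open>b (Suc i)\<close> and \<open>b (2 * h + 1 - i)\<close>:
  the two cross terms must cancel, and they are the superdiagonal entries in question.\<close>

lemma alpha_symmetric:
  assumes a: "a \<in> unip" and i: "i < h"
  shows "alpha (2 * h - i) a = - alpha i a"
proof -
  let ?v = "b (Suc i)" and ?w = "b (2 * h + 1 - i)"
  let ?v' = "a ?v - ?v" and ?w' = "a ?w - ?w"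
  have v': "?v' \<in> fil (Suc i)" using i by (intro unip_fil[OF a] b_in_fil) auto
  have w': "?w' \<in> fil (2 * h + 1 - i)" using i by (intro unip_fil[OF a] b_in_fil) auto
  have wc: "form ?v ?w' = - alpha (2 * h - i) a * (- 1)"
  proof -
    have "form ?v ?w' = - form ?w' ?v" by (rule form_skew)
    also have "\<dots> = coef (2 * h - i) ?w'" using i by (simp add: form_eq_coef)
    also have "\<dots> = alpha (2 * h - i) a"
      using i by (simp add: alpha_def coef_b Suc_diff_le)
    finally show ?thesis by simp
  qed
  have vc: "form ?v' ?w = alpha i a"
    using i by (simp add: form_eq_coef alpha_def coef_b)
  \<comment> \<open>\<open>?v'\<close> involves basis vectors of index at most \<open>i\<close> and
    \<open>?w'\<close> those of index at most \<open>2 * h - i\<close>, so no pair reaches the index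
    sum \<open>2 * h + 1\<close>.\<close>
  have vw': "form ?v' ?w' = 0"
  proof -
    have "form ?v' (\<Sum>k\<le>2 * h + 1. scale (coef k ?w') (b k)) = 0"
      unfolding form_sum_right
    proof (rule sum.neutral, rule ballI)
      fix k assume k: "k \<in> {..2 * h + 1}"
      show "form ?v' (scale (coef k ?w') (b k)) = 0"
      proof (cases "2 * h + 1 - i \<le> k")
        case True
        then have "coef k ?w' = 0" using k by (intro fil_coef[OF w']) auto
        then show ?thesis by simp
      next
        case False
        then have "coef (2 * h + 1 - k) ?v' = 0" using k i by (intro fil_coef[OF v']) auto
        then show ?thesis using k by (simp add: form_scale_right form_eq_coef)
      qed
    qed
    then show ?thesis using expand[of ?w'] by simp
  qed
  have "form ?v ?w = form (?v + ?v') (?w + ?w')"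
    using Sp_form[OF unip_Sp[OF a], of ?v ?w] by simp
  also have "\<dots> = form ?v ?w + form ?v ?w' + form ?v' ?w + form ?v' ?w'"
    unfolding form_add_left form_add_right by simp
  finally have "form ?v ?w' + form ?v' ?w = 0" using vw' by simp
  then show ?thesis unfolding wc vc by (simp add: eq_neg_iff_add_eq_0)
qed

text \<open>Each application of \<open>a - 1\<close> lowers the leading index by one and picks up
  one superdiagonal entry.\<close>

lemma coef_funpow_unip_diff:
  assumes a: "a \<in> unip" and dk: "d + k \<le> 2 * h + 1" and v: "v \<in> fil (Suc (d + k))"
  shows "((\<lambda>w. a w - w) ^^ k) v \<in> fil (Suc d) \<and>
    coef d (((\<lambda>w. a w - w) ^^ k) v) = (\<Prod>i\<in>{d..<d + k}. alpha i a) * coef (d + k) v"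
  using dk v
proof (induction k arbitrary: d)
  case 0
  then show ?case by simp
next
  case (Suc k)
  define u where "u = ((\<lambda>w. a w - w) ^^ k) v"
  have u: "u \<in> fil (Suc (Suc d))"
      "coef (Suc d) u = (\<Prod>i\<in>{Suc d..<Suc d + k}. alpha i a) * coef (Suc d + k) v"
    using Suc.IH[of "Suc d"] Suc.prems by (simp_all add: u_def)
  have "{d..<d + Suc k} = insert d {Suc d..<Suc d + k}" by auto
  then have "coef d (a u - u) = (\<Prod>i\<in>{d..<d + Suc k}. alpha i a) * coef (d + Suc k) v"
    using coef_unip_diff[OF a _ u(1)] u(2) Suc.prems by simp
  then show ?case using unip_fil[OF a u(1)] by (simp add: u_def)
qed

definition transv :: "'f \<Rightarrow> 'v \<Rightarrow> 'v" where
  "transv c v = v + scale (c * coef (2 * h + 1) v) (b 0)"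

text \<open>The exponent is one less than the dimension, so only the top corner of the matrix
  survives, and it is the product of all superdiagonal entries.\<close>

lemma funpow_unip_diff:
  assumes a: "a \<in> unip"
  shows "((\<lambda>w. a w - w) ^^ (2 * h + 1)) v =
    scale ((\<Prod>i<2 * h + 1. alpha i a) * coef (2 * h + 1) v) (b 0)"
proof (rule eq_if_coef)
  fix k assume k: "k \<le> 2 * h + 1"
  let ?u = "((\<lambda>w. a w - w) ^^ (2 * h + 1)) v"
  have "?u \<in> fil 1" "coef 0 ?u = (\<Prod>i<2 * h + 1. alpha i a) * coef (2 * h + 1) v"
    using coef_funpow_unip_diff[OF a, of 0 "2 * h + 1" v] fil_top[of "Suc (2 * h + 1)" v]
    by (simp_all add: lessThan_atLeast0)
  then show "coef k ?u = coef k (scale ((\<Prod>i<2 * h + 1. alpha i a) * coef (2 * h + 1) v) (b 0))"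
    using fil_coef[of ?u 1 k] k by (cases "k = 0") (auto simp: coef_b)
qed

lemma transv_in_unip: "transv c \<in> unip"
proof (rule unipI)
  have "transv c = (\<lambda>v. v + scale (- c * form v (b 0)) (b 0))"
    by (auto simp: transv_def coef_def fun_eq_iff)
  then show "transv c \<in> carrier (Sp scale form)" using transvection_in_Sp[OF finite_UNIV, of "- c" "b 0"] by simp
  show "transv c (b i) - b i \<in> fil i" if "i \<le> 2 * h + 1" for i
    using that by (auto simp: transv_def coef_b intro!: fil_scale b_in_fil zero_in_fil)
qed

lemma transv_comp: "transv c \<circ> transv d = transv (c + d)"
  by (auto simp: transv_def fun_eq_iff coef_b algebra_simps scale_left_distrib)

lemma transv_funpow: "transv c ^^ n = transv (of_nat n * c)"
proof (induction n)
  case 0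
  show ?case by (simp add: transv_def fun_eq_iff)
next
  case (Suc n)
  then show ?case by (simp add: transv_comp algebra_simps)
qed

lemma transv_inject: "transv c = transv d \<longleftrightarrow> c = d"
proof
  assume "transv c = transv d"
  then have "coef 0 (transv c (b (2 * h + 1))) = coef 0 (transv d (b (2 * h + 1)))" by simp
  then show "c = d" by (simp add: transv_def coef_b)
qed simp

text \<open>For \<open>i < h\<close> this adds multiples of \<open>b i\<close> to
  \<open>b (Suc i)\<close> and of \<open>b (2 * h - i)\<close> to \<open>b (2 * h + 1 - i)\<close>.
  For \<open>i = h\<close> the two summands coincide and it is a transvection along
  \<open>b h\<close>, whence the factor 2 in \<open>alpha_root_element\<close>.\<close>

definition root_element :: "nat \<Rightarrow> 'f \<Rightarrow> 'v \<Rightarrow> 'v" where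
  "root_element i t v = v + scale t (scale (form v (b i)) (b (2 * h - i)) + scale (form v (b (2 * h - i))) (b i))"

lemma root_element_in_unip:
  assumes i: "i \<le> h"
  shows "root_element i t \<in> unip"
proof (rule unipI)
  define u where "u = b i"
  define w where "w = b (2 * h - i)"
  have orth: "form u w = 0" "form w u = 0"
    using i by (auto simp: form_b u_def w_def)
  have eq: "root_element i t = (\<lambda>v. v + scale t (scale (form v u) w + scale (form v w) u))"
    by (simp add: root_element_def fun_eq_iff u_def w_def)
  show "root_element i t \<in> carrier (Sp scale form)"
    unfolding eq using finite_UNIV
  proof (rule form_preserving_in_Sp)
    show "form (x + scale t (scale (form x u) w + scale (form x w) u))
        (y + scale t (scale (form y u) w + scale (form y w) u)) = form x y" for x y
      using form_skew[of u y] form_skew[of w y]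
      by (simp add: form_simps orth alternating algebra_simps)
  qed (simp_all add: form_simps algebra_simps scale_right_distrib scale_left_distrib)
  show "root_element i t (b k) - b k \<in> fil k" if "k \<le> 2 * h + 1" for k
  proof -
    have "scale (form (b k) (b i)) (b (2 * h - i)) \<in> fil k"
    proof (cases "k + i = 2 * h + 1")
      case True
      then show ?thesis using i by (intro fil_scale b_in_fil) auto
    next
      case False
      then show ?thesis using that i by (simp add: form_b zero_in_fil)
    qed
    moreover have "scale (form (b k) (b (2 * h - i))) (b i) \<in> fil k"
    proof (cases "k + (2 * h - i) = 2 * h + 1")
      case True
      then show ?thesis using i by (intro fil_scale b_in_fil) auto
    next
      case False
      then show ?thesis using that i by (simp add: form_b zero_in_fil)
    qed
    ultimately show ?thesis by (simp add: root_element_def fil_scale fil_add)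
  qed
qed

lemma alpha_root_element:
  assumes "i \<le> h" "k \<le> h"
  shows "alpha k (root_element i t) = (if k = i then if i = h then - 2 * t else t else 0)"
  using assms by (auto simp: alpha_def root_element_def coef_b form_b)

text \<open>Since the entries are additive, multiplying by \<open>root_element m\<close> sets entry
  \<open>m\<close> and leaves the others with index at most \<open>h\<close> alone. Entry
  \<open>h\<close> requires dividing by 2.\<close>

lemma alpha_surj:
  assumes "(2 :: 'f) \<noteq> 0"
  shows "\<exists>a\<in>unip. \<forall>i\<le>h. alpha i a = t i"
proof -
  have "\<exists>a\<in>unip. \<forall>i\<le>h. alpha i a = (if i < m then t i else 0)" if "m \<le> Suc h" for m
    using that
  proof (induction m)
    case 0
    show ?case by (rule bexI[OF _ id_in_unip]) (auto simp: alpha_def coef_b)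
  next
    case (Suc m)
    then obtain a where a: "a \<in> unip" "\<And>i. i \<le> h \<Longrightarrow> alpha i a = (if i < m then t i else 0)"
      by auto
    define r where "r = root_element m (if m = h then - t m / 2 else t m)"
    have r: "r \<in> unip" using Suc.prems by (simp add: r_def root_element_in_unip)
    have "alpha i (a \<circ> r) = (if i < Suc m then t i else 0)" if "i \<le> h" for i
      using that Suc.prems assms a r by (auto simp: alpha_comp r_def alpha_root_element)
    then show ?case using comp_in_unip[OF a(1) r] by blast
  qed
  from this[of "Suc h"] show ?thesis by (auto simp: less_Suc_eq_le)
qed

text \<open>Reflecting \<open>i\<close> to \<open>2 * h - i\<close> pairs the entries around the
  middle one up to sign; the \<open>h\<close> signs cancel because \<open>h\<close> is even.\<close>

lemma prod_alpha:
  assumes a: "a \<in> unip" and h: "even h"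
  shows "(\<Prod>i<2 * h + 1. alpha i a) = alpha h a * (\<Prod>i<h. alpha i a)\<^sup>2"
proof -
  have "(\<Prod>i\<in>{Suc h..<2 * h + 1}. alpha i a) = (\<Prod>i<h. alpha (2 * h - i) a)"
    by (rule prod.reindex_bij_witness[of _ "\<lambda>i. 2 * h - i" "\<lambda>i. 2 * h - i"]) auto
  also have "\<dots> = (\<Prod>i<h. - alpha i a)"
    by (rule prod.cong) (auto simp: alpha_symmetric[OF a])
  also have "\<dots> = (\<Prod>i<h. alpha i a)" using h by (simp add: prod_uminus)
  finally have "(\<Prod>i\<in>{Suc h..<2 * h + 1}. alpha i a) = (\<Prod>i<h. alpha i a)" .
  moreover have "(\<Prod>i<2 * h + 1. alpha i a) =
      (\<Prod>i\<in>{..<h} \<union> insert h {Suc h..<2 * h + 1}. alpha i a)"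
    by (rule prod.cong) auto
  then have "(\<Prod>i<2 * h + 1. alpha i a) =
      (\<Prod>i<h. alpha i a) * (alpha h a * (\<Prod>i\<in>{Suc h..<2 * h + 1}. alpha i a))"
    by (subst (asm) prod.union_disjoint) auto
  ultimately show ?thesis by (simp add: power2_eq_square algebra_simps)
qed

end

section \<open>Squares in finite fields\<close>

lemma finite_field_CHAR:
  assumes "Factorial_Ring.prime p" and "CARD('f::{field,finite}) = p ^ k"
  shows "CHAR('f) = p"
proof -
  have "CHAR('f) > 0" by (rule finite_imp_CHAR_pos) simp
  then have "Factorial_Ring.prime CHAR('f)" by (rule prime_CHAR_semidom)
  moreover have "CHAR('f) dvd p ^ k" using CHAR_dvd_CARD[where ?'a = 'f] assms(2) by simp
  ultimately show ?thesis using assms(1) by (meson prime_dvd_power primes_dvd_imp_eq)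
qed

text \<open>Multiplication by \<open>x\<close> permutes the nonzero elements, so their product is
  unchanged by the factor \<open>x ^ card ?A\<close>.\<close>

lemma finite_field_power_card:
  assumes "(x :: 'f::{field,finite}) \<noteq> 0"
  shows "x ^ (CARD('f) - 1) = 1"
proof -
  let ?A = "UNIV - {0 :: 'f}"
  have "(\<Prod>y\<in>?A. y) = (\<Prod>y\<in>?A. x * y)"
    by (rule prod.reindex_bij_witness[of _ "\<lambda>y. x * y" "\<lambda>y. y / x"]) (use assms in auto)
  also have "\<dots> = x ^ card ?A * (\<Prod>y\<in>?A. y)" by (simp add: prod.distrib)
  finally show ?thesis by (simp add: card_Diff_singleton)
qed

text \<open>Otherwise squaring modulo \<open>p\<close> would be onto, hence injective, on the
  nonzero residues, but \<open>1\<close> and \<open>p - 1\<close> have the same square.\<close>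

lemma exists_not_QuadRes:
  assumes p: "Factorial_Ring.prime p" "p > 2"
  shows "\<exists>n::nat. n > 0 \<and> \<not> p dvd n \<and> \<not> QuadRes (int p) (int n)"
proof (rule ccontr)
  assume neg: "\<not> ?thesis"
  define f where "f y = (y\<^sup>2) mod p" for y :: nat
  have p1: "p > 1" using p by simp
  have sub: "{1..<p} \<subseteq> f ` {1..<p}"
  proof
    fix n assume n: "n \<in> {1..<p}"
    then have "\<not> p dvd n" by (auto dest: dvd_imp_le)
    then obtain y where y: "[y\<^sup>2 = int n] (mod int p)" using neg n by (auto simp: QuadRes_def)
    define z where "z = nat (y mod int p)"
    have z: "int z = y mod int p" "z < p" using p1 by (auto simp: z_def nat_less_iff)
    have "[(int z)\<^sup>2 = int n] (mod int p)"
      using y by (simp add: z cong_def power_mod)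
    then have "[z\<^sup>2 = n] (mod p)" by (simp flip: cong_int_iff of_nat_power)
    then have "f z = n" using n by (simp add: f_def cong_def)
    moreover have "z \<noteq> 0" using \<open>f z = n\<close> n by (auto simp: f_def intro: ccontr)
    ultimately show "n \<in> f ` {1..<p}" using z by force
  qed
  have "card {1..<p} \<le> card (f ` {1..<p})" by (rule card_mono[OF _ sub]) simp
  then have "inj_on f {1..<p}"
    using card_image_le[of "{1..<p}" f] by (intro eq_card_imp_inj_on) auto
  moreover have "f 1 = f (p - 1)"
  proof -
    have "[(int p - 1)\<^sup>2 = 1] (mod int p)"
      by (auto simp: cong_iff_dvd_diff power2_eq_square algebra_simps)
    then have "[(p - 1)\<^sup>2 = 1] (mod p)"
      using p1 by (simp flip: cong_int_iff add: of_nat_diff)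
    then show ?thesis by (simp add: f_def cong_def)
  qed
  ultimately have "1 = p - 1" using p1 p(2) by (auto dest: inj_onD)
  then show False using p by simp
qed

text \<open>A nonresidue \<open>n\<close> modulo \<open>p\<close> stays a nonsquare in an extension
  of odd degree: if it were \<open>s\<^sup>2\<close>, then raising to the power
  \<open>(p ^ k - 1) div 2\<close> would give 1, whereas Euler's criterion gives an odd power of
  \<open>- 1\<close>.\<close>

lemma exists_nonsquare_of_nat:
  assumes p: "Factorial_Ring.prime p" "p > 2" and card: "CARD('f::{field,finite}) = p ^ k"
    and k: "odd k"
  shows "\<exists>n>0. \<not> p dvd n \<and> (\<forall>s::'f. s\<^sup>2 \<noteq> of_nat n)"
proof -
  have char: "CHAR('f) = p" by (rule finite_field_CHAR[OF p(1) card])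
  obtain n :: nat where n: "n > 0" "\<not> p dvd n" "\<not> QuadRes (int p) (int n)"
    using exists_not_QuadRes[OF p] by blast
  define m where "m = (p - 1) div 2"
  have "odd p" using p prime_odd_nat by auto
  then have p_m: "p - 1 = 2 * m" by (simp add: m_def)
  have "Legendre (int n) (int p) = - 1"
    using n by (simp add: Legendre_def cong_0_iff)
  then have "[int n ^ m = - 1] (mod int p)"
    using euler_criterion[OF p, of "int n"] by (simp add: m_def cong_sym)
  then have "(of_int (int n ^ m) :: 'f) = of_int (- 1)"
    unfolding of_int_eq_iff_cong_CHAR char .
  then have nm: "(of_nat n :: 'f) ^ m = - 1" by simp
  \<comment> \<open>The quotient of \<open>p ^ k - 1\<close> by \<open>p - 1\<close>, a sum of
    \<open>k\<close> odd terms and therefore odd.\<close>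
  define c where "c = (\<Sum>i<k. p ^ i)"
  have "p ^ i = 1 + (p - 1) * (\<Sum>l<i. p ^ l)" for i
    using p by (cases p; induction i) (auto simp: algebra_simps)
  then have pk: "p ^ k = 1 + (p - 1) * c" unfolding c_def .
  have "odd (\<Sum>l<i. p ^ l) \<longleftrightarrow> odd i" for i
    using \<open>odd p\<close> by (induction i) auto
  then have "odd c" using k by (simp add: c_def)
  have "s\<^sup>2 \<noteq> of_nat n" for s :: 'f
  proof
    assume s: "s\<^sup>2 = of_nat n"
    have "(2 :: 'f) \<noteq> 0" using char p of_nat_eq_0_iff_char_dvd[of 2, where ?'a = 'f]
      by (auto dest: dvd_imp_le)
    have "s \<noteq> 0" using s nm p_m p by (intro notI) (simp add: zero_power)
    then have "1 = s ^ (2 * m * c)"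
      using finite_field_power_card[of s] pk card p_m by simp
    also have "\<dots> = ((s\<^sup>2) ^ m) ^ c" by (simp flip: power_mult)
    also have "\<dots> = - 1" using s nm \<open>odd c\<close> by simp
    finally show False using \<open>(2 :: 'f) \<noteq> 0\<close> by (simp add: eq_neg_iff_add_eq_0)
  qed
  then show ?thesis using n by blast
qed

text \<open>By Euler's criterion \<open>- 1\<close> is a square already in the prime field, as
  \<open>(p - 1) div 2\<close> is even.\<close>

lemma exists_sqrt_minus_one:
  assumes p: "Factorial_Ring.prime p" "p > 2" "[p = 1] (mod 4)"
    and card: "CARD('f::{field,finite}) = p ^ k"
  shows "\<exists>i::'f. i\<^sup>2 = - 1"
proof -
  have char: "CHAR('f) = p" by (rule finite_field_CHAR[OF p(1) card])
  have "p mod 4 = 1" using p(3) by (simp add: cong_def)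
  then have "even ((p - 1) div 2)" by presburger
  then have "[Legendre (- 1) (int p) = 1] (mod int p)"
    using euler_criterion[OF p(1,2), of "- 1"] by simp
  moreover have "\<not> [- 1 = 1] (mod int p)"
    using p(2) by (auto simp: cong_iff_dvd_diff dest: zdvd_imp_le)
  ultimately have "QuadRes (int p) (- 1)"
    using p(2) by (auto simp: Legendre_def cong_0_iff split: if_splits)
  then obtain y where "[y\<^sup>2 = - 1] (mod int p)" by (auto simp: QuadRes_def)
  then have "(of_int (y\<^sup>2) :: 'f) = of_int (- 1)"
    unfolding of_int_eq_iff_cong_CHAR char .
  then have "(of_int y :: 'f)\<^sup>2 = - 1" by simp
  then show ?thesis by blast
qed

section \<open>The unipotent group is not FSZ\<close>

text \<open>
  The conditions \<open>a\<^sup>L = (a u)\<^sup>L = g\<close> for the transvection \<open>g\<close> with parameter \<open>c\<close>, where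
  \<open>x = \<alpha>\<^sub>0\<close>, \<open>y = \<alpha>\<^sub>1\<close>, \<open>z = \<alpha>\<^sub>h\<close> and \<open>r\<close> is the product of the remaining \<open>\<alpha>\<^sub>i\<close> with \<open>i < h\<close>.
  For given \<open>r\<close>, a solution is determined by \<open>s = x (x + 1) y r\<close>, because
  eliminating \<open>z\<close> from the conditions gives \<open>2 x + 1 = - s\<^sup>2 / c\<close>.
\<close>

definition power_cond :: "'f::field \<Rightarrow> 'f \<Rightarrow> 'f \<Rightarrow> 'f \<Rightarrow> 'f \<Rightarrow> bool" where
  "power_cond c x y z r \<longleftrightarrow> z * (x * y * r)\<^sup>2 = c \<and> (z + 1) * ((x + 1) * y * r)\<^sup>2 = c"

lemma power_cond_nonzero:
  assumes "power_cond c x y z r" "c \<noteq> 0"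
  shows "x \<noteq> 0" "x + 1 \<noteq> 0" "y \<noteq> 0" "r \<noteq> 0"
  using assms by (auto simp: power_cond_def)

text \<open>Multiplying the second equation by \<open>x\<^sup>2\<close> and inserting the first
  gives \<open>c * (x + 1)\<^sup>2 + s\<^sup>2 = c * x\<^sup>2\<close>, which is linear in
  \<open>x\<close>.\<close>

lemma power_cond_solve:
  fixes c :: "'f::field"
  assumes two: "(2 :: 'f) \<noteq> 0" and c: "c \<noteq> 0" and cond: "power_cond c x y z r"
    and s: "s = x * (x + 1) * y * r"
  shows "x = (- s\<^sup>2 / c - 1) / 2" and "y = s / (x * (x + 1) * r)" and "z = c / (x * y * r)\<^sup>2"
proof -
  note nz = power_cond_nonzero[OF cond c]
  have z: "z = c / (x * y * r)\<^sup>2" using nz cond by (simp add: power_cond_def field_simps)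
  then show "z = c / (x * y * r)\<^sup>2" .
  show "y = s / (x * (x + 1) * r)" using nz by (simp add: s)
  have eqs: "z * (x * y * r)\<^sup>2 = c" "(z + 1) * ((x + 1) * y * r)\<^sup>2 = c"
    using cond by (simp_all add: power_cond_def)
  have s2: "s\<^sup>2 = x\<^sup>2 * ((x + 1) * y * r)\<^sup>2"
    by (simp add: s power2_eq_square mult_ac)
  have "c * (x + 1)\<^sup>2 + s\<^sup>2 = z * (x * y * r)\<^sup>2 * (x + 1)\<^sup>2 + x\<^sup>2 * ((x + 1) * y * r)\<^sup>2"
    by (simp only: eqs(1) s2)
  also have "\<dots> = (z + 1) * ((x + 1) * y * r)\<^sup>2 * x\<^sup>2"
    by (simp add: power2_eq_square algebra_simps)
  finally have "c * (x + 1)\<^sup>2 + s\<^sup>2 = c * x\<^sup>2" by (simp only: eqs(2))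
  then have "c * (2 * x + 1) = - s\<^sup>2"
    by (simp add: eq_neg_iff_add_eq_0 power2_eq_square algebra_simps)
  then have "2 * x + 1 = - s\<^sup>2 / c" using c by (simp add: field_simps)
  then have "2 * x = - s\<^sup>2 / c - 1" by (simp add: algebra_simps)
  then show "x = (- s\<^sup>2 / c - 1) / 2" using two by (simp add: field_simps)
qed

text \<open>The excluded values of \<open>s\<close> are the degenerate ones:
  \<open>s\<^sup>2 = - c\<close> means \<open>x = 0\<close>, and \<open>s\<^sup>2 = c\<close> means
  \<open>x = - 1\<close>.\<close>

lemma power_cond_solution:
  fixes c :: "'f::field"
  assumes two: "(2 :: 'f) \<noteq> 0" and c: "c \<noteq> 0" and s: "s \<noteq> 0" "s\<^sup>2 \<noteq> c" "s\<^sup>2 \<noteq> - c" and r: "r \<noteq> 0"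
    and x: "x = (- s\<^sup>2 / c - 1) / 2" and y: "y = s / (x * (x + 1) * r)"
    and z: "z = c / (x * y * r)\<^sup>2"
  shows "power_cond c x y z r" and "x * (x + 1) * y * r = s"
proof -
  have x2: "2 * x = - s\<^sup>2 / c - 1" using two by (simp add: x)
  have x0: "x \<noteq> 0"
  proof
    assume "x = 0"
    then have "- s\<^sup>2 = c" using x2 c by (simp add: field_simps)
    then show False using s(3) by (metis minus_minus)
  qed
  have x1: "x + 1 \<noteq> 0"
  proof
    assume "x + 1 = 0"
    then have "2 * x = - 2" by (simp add: add_eq_0_iff2)
    then have "s\<^sup>2 / c = 1" using x2 by (simp add: algebra_simps)
    then show False using s(2) c by (simp add: field_simps)
  qed
  have y0: "y \<noteq> 0" using y s r x0 x1 by simp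
  show sxy: "x * (x + 1) * y * r = s" using y r x0 x1 by simp
  have cx: "c * (2 * x + 1) = - s\<^sup>2" using x2 c by (simp add: field_simps)
  have zc: "z * (x * y * r)\<^sup>2 = c" using z x0 y0 r by simp
  have "x\<^sup>2 * ((z + 1) * ((x + 1) * y * r)\<^sup>2) = z * (x * y * r)\<^sup>2 * (x + 1)\<^sup>2 + (x * (x + 1) * y * r)\<^sup>2"
    by (simp add: power2_eq_square algebra_simps)
  also have "\<dots> = c * (x + 1)\<^sup>2 + s\<^sup>2" by (simp only: zc sxy)
  also have "\<dots> = x\<^sup>2 * c" using cx by (simp add: eq_neg_iff_add_eq_0 power2_eq_square algebra_simps)
  finally show "power_cond c x y z r" using x0 zc by (simp add: power_cond_def)
qed

locale symplectic_basis_finite_field = symplectic_basis scale form h b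
  for scale :: "'f::{field,finite} \<Rightarrow> 'v::ab_group_add \<Rightarrow> 'v" and form :: "'v \<Rightarrow> 'v \<Rightarrow> 'f"
    and h :: nat and b :: "nat \<Rightarrow> 'v" +
  fixes p k j :: nat
  assumes prime: "Factorial_Ring.prime p" and p3: "p > 3" and p_mod: "[p = 1] (mod 4)"
    and k: "odd k" and card_field: "CARD('f) = p ^ k" and j: "j > 0"
    and dim: "p ^ j = 2 * h + 1"
begin

section \<open>Powers and order of the unitriangular group\<close>

lemma char: "CHAR('f) = p"
  by (rule finite_field_CHAR[OF prime card_field])

lemma of_nat_p: "of_nat p = (0 :: 'f)"
  using of_nat_CHAR[where ?'a = 'f] by (simp add: char)

lemma two_neq_0: "(2 :: 'f) \<noteq> 0"
  using p3 of_nat_eq_0_iff_char_dvd[of 2, where ?'a = 'f] by (auto simp: char dest: dvd_imp_le)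

lemma even_h: "even h"
proof -
  have "[p ^ j = 1 ^ j] (mod 4)" using p_mod by (rule cong_pow)
  then have "(2 * h + 1) mod 4 = 1" by (simp add: dim cong_def)
  then show ?thesis by presburger
qed

text \<open>Makes the indices \<open>0\<close>, \<open>1\<close> and \<open>h\<close> distinct, as
  \<open>shift\<close> and \<open>rest\<close> require.\<close>

lemma h_ge_2: "2 \<le> h"
proof -
  have "p ^ 1 \<le> p ^ j" using p3 j by (intro power_increasing) auto
  then show ?thesis using p3 dim by simp
qed

text \<open>In characteristic \<open>p\<close> the power is \<open>1 + (a - 1) ^^ (p ^ j)\<close>,
  and \<open>p ^ j = 2 * h + 1\<close> is exactly the exponent of
  \<open>funpow_unip_diff\<close>.\<close>

lemma funpow_unip:
  assumes a: "a \<in> unip"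
  shows "a ^^ (p ^ j) = transv (alpha h a * (\<Prod>i<h. alpha i a)\<^sup>2)"
proof
  fix v
  have "Vector_Spaces.linear scale scale a" using unip_Sp[OF a] by (simp add: carrier_Sp_iff)
  then have "(a ^^ (p ^ j)) v = v + ((\<lambda>w. a w - w) ^^ (p ^ j)) v"
    using prime of_nat_p by (rule funpow_prime_power)
  then show "(a ^^ (p ^ j)) v = transv (alpha h a * (\<Prod>i<h. alpha i a)\<^sup>2) v"
    unfolding dim funpow_unip_diff[OF a] prod_alpha[OF a even_h] transv_def .
qed

text \<open>The exponent divides \<open>p ^ Suc j\<close>: the \<open>p ^ j\<close>-th power of each
  element is a transvection, and its \<open>p\<close>-th power is trivial.\<close>

lemma card_unip: "\<exists>t. card unip = p ^ t"
proof -
  interpret S: group "Sp scale form" by (rule group_Sp)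
  interpret U: group "Sp scale form\<lparr>carrier := unip\<rparr>"
    using subgroup_unip by (rule S.subgroup_imp_group)
  have "\<exists>t. order (Sp scale form\<lparr>carrier := unip\<rparr>) = p ^ t"
  proof (rule U.order_eq_prime_power[OF _ prime])
    show "finite (carrier (Sp scale form\<lparr>carrier := unip\<rparr>))"
      using finite_carrier_Sp[OF finite_UNIV] unip_Sp by (auto intro: finite_subset)
    fix a assume "a \<in> carrier (Sp scale form\<lparr>carrier := unip\<rparr>)"
    then have a: "a \<in> unip" by simp
    have "a ^^ (p ^ Suc j) = (a ^^ (p ^ j)) ^^ p" by (simp add: funpow_mult mult.commute)
    also have "\<dots> = id"
      unfolding funpow_unip[OF a] transv_funpow of_nat_p by (simp add: transv_def fun_eq_iff)
    finally show "a [^]\<^bsub>Sp scale form\<lparr>carrier := unip\<rparr>\<^esub> (p ^ Suc j) =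
        \<one>\<^bsub>Sp scale form\<lparr>carrier := unip\<rparr>\<^esub>"
      by (simp add: pow_Sp one_Sp flip: S.nat_pow_consistent)
  qed
  then show ?thesis by (simp add: order_def)
qed

lemma sylow_subgroup_eq_unip:
  assumes P: "sylow_subgroup p (Sp scale form) P" and sub: "P \<subseteq> unip"
  shows "P = unip"
proof -
  interpret S: group "Sp scale form" by (rule group_Sp)
  have finS: "finite (carrier (Sp scale form))" by (rule finite_carrier_Sp[OF finite_UNIV])
  obtain t where t: "card unip = p ^ t" using card_unip by blast
  have "p ^ t dvd order (Sp scale form)"
    using S.lagrange[OF subgroup_unip] t by (metis dvd_triv_right)
  moreover have "order (Sp scale form) \<noteq> 0" using S.order_gt_0_iff_finite finS by simp
  moreover have "\<not> is_unit p" using prime by auto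
  ultimately have "t \<le> multiplicity p (order (Sp scale form))" by (simp add: power_dvd_iff_le_multiplicity)
  then have "card unip \<le> card P"
    using P p3 by (simp add: t sylow_subgroup_def power_increasing)
  moreover have "finite unip" using finS unip_Sp by (auto intro: finite_subset)
  ultimately show ?thesis using sub by (simp add: card_seteq)
qed

text \<open>An arbitrary choice with these superdiagonal entries suffices: right multiplication by
  it is injective and changes \<open>alpha 0\<close>, \<open>alpha 1\<close> and
  \<open>alpha h\<close> in a controlled way.\<close>

definition shift :: "'f \<Rightarrow> 'f \<Rightarrow> 'f \<Rightarrow> 'v \<Rightarrow> 'v" where
  "shift x y z = (SOME a. a \<in> unip \<and> (\<forall>i\<le>h. alpha i a =
    (if i = 0 then x else if i = 1 then y else if i = h then z else 0)))"

lemma shift: "shift x y z \<in> unip"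
  and alpha_shift: "i \<le> h \<Longrightarrow> alpha i (shift x y z) =
    (if i = 0 then x else if i = 1 then y else if i = h then z else 0)"
  using someI_ex[OF alpha_surj[OF two_neq_0,
      of "\<lambda>i. if i = 0 then x else if i = 1 then y else if i = h then z else 0", unfolded Bex_def]]
  unfolding shift_def by blast+

definition rest :: "('v \<Rightarrow> 'v) \<Rightarrow> 'f" where
  "rest a = (\<Prod>i\<in>{2..<h}. alpha i a)"

text \<open>The quantity \<open>s\<close> of \<open>power_cond_solve\<close>; with
  \<open>rest\<close> and \<open>c\<close> it determines \<open>alpha 0\<close>,
  \<open>alpha 1\<close> and \<open>alpha h\<close> of a solution.\<close>

definition invariant :: "('v \<Rightarrow> 'v) \<Rightarrow> 'f" where
  "invariant a = alpha 0 a * (alpha 0 a + 1) * alpha 1 a * rest a"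

lemma prod_alpha_split: "(\<Prod>i<h. alpha i a) = alpha 0 a * alpha 1 a * rest a"
proof -
  have "{..<h} = insert 0 (insert 1 {2..<h})" using h_ge_2 by auto
  then show ?thesis by (simp add: rest_def)
qed

lemma alpha_comp_shift:
  assumes "a \<in> unip"
  shows "alpha 0 (a \<circ> shift x y z) = alpha 0 a + x"
    and "alpha 1 (a \<circ> shift x y z) = alpha 1 a + y"
    and "alpha h (a \<circ> shift x y z) = alpha h a + z"
    and "rest (a \<circ> shift x y z) = rest a"
  using assms h_ge_2 by (auto simp: alpha_comp shift alpha_shift rest_def intro!: prod.cong)

definition solutions :: "'f \<Rightarrow> ('v \<Rightarrow> 'v) set" where
  "solutions c = {a \<in> unip. power_cond c (alpha 0 a) (alpha 1 a) (alpha h a) (rest a)}"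

text \<open>Multiplying by \<open>shift 1 0 1\<close> adds 1 to \<open>alpha 0\<close> and
  \<open>alpha h\<close>, so by \<open>funpow_unip\<close> the two power equations become
  \<open>power_cond\<close>.\<close>

lemma FSZ_set_unip:
  "FSZ_set (Sp scale form\<lparr>carrier := unip\<rparr>) (p ^ j) (shift 1 0 1) (transv c) = solutions c"
proof -
  interpret S: group "Sp scale form" by (rule group_Sp)
  show ?thesis
    by (auto simp: FSZ_set_def solutions_def power_cond_def mult_Sp pow_Sp funpow_unip comp_in_unip
        shift transv_inject prod_alpha_split alpha_comp_shift[unfolded One_nat_def] simp flip: S.nat_pow_consistent)
qed

text \<open>For nonsquare \<open>c\<close> every nonzero \<open>s\<close> is admissible, while for
  \<open>c = 1\<close> the value \<open>s = 1\<close> is not. The map \<open>T\<close> carries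
  solutions for \<open>1\<close> injectively to solutions for \<open>c\<close> with the same
  \<open>invariant\<close> and \<open>rest\<close>, so it misses those with invariant 1.\<close>

lemma card_solutions_less:
  assumes c: "\<And>s. s\<^sup>2 \<noteq> c" and c0: "c \<noteq> 0"
  shows "card (solutions 1) < card (solutions c)"
proof -
  define X where "X s = (- s\<^sup>2 / c - 1) / 2" for s
  define Y where "Y s r = s / (X s * (X s + 1) * r)" for s r
  define Z where "Z s r = c / (X s * Y s r * r)\<^sup>2" for s r
  obtain i :: 'f where i: "i\<^sup>2 = - 1"
    using exists_sqrt_minus_one[OF prime _ p_mod card_field] p3 by auto
  have mc: "s\<^sup>2 \<noteq> - c" for s
  proof
    assume "s\<^sup>2 = - c"
    then have "(i * s)\<^sup>2 = c" using i by (simp add: power_mult_distrib)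
    then show False using c by blast
  qed
  have sol: "power_cond c (X s) (Y s r) (Z s r) r" "X s * (X s + 1) * Y s r * r = s"
    if "s \<noteq> 0" "r \<noteq> 0" for s r
    using power_cond_solution[OF two_neq_0 c0 that(1) c mc that(2) X_def Y_def Z_def] by auto
  \<comment> \<open>The right factor replaces the three entries by those that
    \<open>power_cond_solution\<close> prescribes for \<open>c\<close>.\<close>
  define T where "T a = a \<circ> shift (X (invariant a) - alpha 0 a)
    (Y (invariant a) (rest a) - alpha 1 a) (Z (invariant a) (rest a) - alpha h a)" for a
  have T: "T a \<in> solutions c" "invariant (T a) = invariant a" "rest (T a) = rest a"
    if a: "a \<in> solutions 1" for a
  proof -
    have aU: "a \<in> unip" and cond: "power_cond 1 (alpha 0 a) (alpha 1 a) (alpha h a) (rest a)"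
      using a by (auto simp: solutions_def)
    have nz: "invariant a \<noteq> 0" "rest a \<noteq> 0"
      using power_cond_nonzero[OF cond] by (auto simp: invariant_def)
    have al: "alpha 0 (T a) = X (invariant a)" "alpha 1 (T a) = Y (invariant a) (rest a)"
      "alpha h (T a) = Z (invariant a) (rest a)" and r: "rest (T a) = rest a"
      using alpha_comp_shift[OF aU] by (simp_all add: T_def)
    show "T a \<in> solutions c"
      unfolding solutions_def mem_Collect_eq al r
      using sol(1)[OF nz] comp_in_unip[OF aU shift] by (simp add: T_def)
    show "invariant (T a) = invariant a"
      unfolding invariant_def[of "T a"] al r by (rule sol(2)[OF nz])
    show "rest (T a) = rest a" by (rule r)
  qed
  have "inj_on T (solutions 1)"
  proof (rule inj_onI)
    fix a a' assume a: "a \<in> solutions 1" and a': "a' \<in> solutions 1" and eq: "T a = T a'"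
    have inv: "invariant a = invariant a'" "rest a = rest a'"
      using T(2,3)[OF a] T(2,3)[OF a'] eq by auto
    have cond: "power_cond 1 (alpha 0 a) (alpha 1 a) (alpha h a) (rest a)"
      "power_cond 1 (alpha 0 a') (alpha 1 a') (alpha h a') (rest a')"
      using a a' by (auto simp: solutions_def)
    note solve = power_cond_solve[OF two_neq_0 one_neq_zero cond(1) invariant_def]
      power_cond_solve[OF two_neq_0 one_neq_zero cond(2) invariant_def]
    have 0: "alpha 0 a = alpha 0 a'" by (simp only: solve(1) solve(4) inv)
    have 1: "alpha 1 a = alpha 1 a'"
      by (subst solve(2), subst solve(5)) (simp only: 0 inv)
    have 2: "alpha h a = alpha h a'"
      by (subst solve(3), subst solve(6)) (simp only: 0 1 inv)
    \<comment> \<open>Equal entries mean that \<open>T\<close> used the same right factor for both,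
      which can be cancelled.\<close>
    obtain w where w: "w \<in> unip" "a \<circ> w = a' \<circ> w"
      using eq inv 0 1 2 shift by (auto simp: T_def)
    have "surj w" using unip_Sp[OF w(1)] by (simp add: carrier_Sp_iff bij_is_surj)
    then show "a = a'" using w(2) by (metis comp_apply ext surjD)
  qed
  moreover have "T ` solutions 1 \<subset> solutions c"
  proof
    show "T ` solutions 1 \<subseteq> solutions c" using T(1) by auto
    obtain a where a: "a \<in> unip" "\<And>i. i \<le> h \<Longrightarrow> alpha i a =
        (if i = 0 then X 1 else if i = 1 then Y 1 1 else if i = h then Z 1 1 else 1)"
      using alpha_surj[OF two_neq_0, of "\<lambda>i. if i = 0 then X 1 else if i = 1 then Y 1 1
        else if i = h then Z 1 1 else 1"] by blast
    have al: "alpha 0 a = X 1" "alpha 1 a = Y 1 1" "alpha h a = Z 1 1" "rest a = 1"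
      using a(2) h_ge_2 by (auto simp: rest_def)
    have "a \<in> solutions c" using a(1) sol(1)[of 1 1] by (simp add: solutions_def al[unfolded One_nat_def])
    moreover have "invariant a = 1" using sol(2)[of 1 1] by (simp add: invariant_def al[unfolded One_nat_def])
    moreover have "invariant a' \<noteq> 1" if a': "a' \<in> solutions 1" for a'
    proof
      assume inv: "invariant a' = 1"
      have cond: "power_cond 1 (alpha 0 a') (alpha 1 a') (alpha h a') (rest a')"
        using a' by (simp add: solutions_def)
      \<comment> \<open>This is the degenerate case: \<open>c = 1\<close> and \<open>s = 1\<close>
        give \<open>(- 1 - 1) / 2\<close>.\<close>
      have "alpha 0 a' = - 1"
        using power_cond_solve(1)[OF two_neq_0 _ cond invariant_def] inv two_neq_0 by simp
      then show False using power_cond_nonzero(2)[OF cond] by simp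
    qed
    ultimately show "T ` solutions 1 \<noteq> solutions c" using T(2) by (metis imageE)
  qed
  moreover have "finite (solutions c)"
    using finite_carrier_Sp[OF finite_UNIV] unip_Sp
    by (auto simp: solutions_def intro: finite_subset)
  ultimately show ?thesis by (metis card_image psubset_card_mono)
qed

text \<open>A nonsquare \<open>n\<close> prime to \<open>p\<close> is coprime to the group order and
  takes \<open>transv 1\<close> to \<open>transv (of_nat n)\<close>, whose solution set is strictly
  larger.\<close>

lemma not_FSZ_unip: "\<not> FSZ (p ^ j) (Sp scale form\<lparr>carrier := unip\<rparr>)"
proof
  interpret S: group "Sp scale form" by (rule group_Sp)
  assume FSZ: "FSZ (p ^ j) (Sp scale form\<lparr>carrier := unip\<rparr>)"
  obtain n where n: "n > 0" "\<not> p dvd n" "\<And>s::'f. s\<^sup>2 \<noteq> of_nat n"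
    using exists_nonsquare_of_nat[OF prime _ card_field k] p3 by auto
  obtain t where t: "card unip = p ^ t" using card_unip by blast
  have "coprime n (p ^ t)"
    using prime_imp_coprime[OF prime n(2)] by (metis coprime_commute coprime_power_right_iff)
  moreover have "transv 1 [^]\<^bsub>Sp scale form\<lparr>carrier := unip\<rparr>\<^esub> n = transv (of_nat n)"
    by (simp add: pow_Sp transv_funpow flip: S.nat_pow_consistent)
  ultimately have "card (solutions 1) = card (solutions (of_nat n))"
    using FSZ n(1) shift transv_in_unip t
    unfolding FSZ_def order_def by (simp flip: FSZ_set_unip)
  moreover have "(of_nat n :: 'f) \<noteq> 0"
    using n(2) by (simp add: of_nat_eq_0_iff_char_dvd char)
  ultimately show False using card_solutions_less[OF n(3)] by simp
qed

end

section \<open>A symplectic basis adapted to a p-subgroup\<close>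

text \<open>The restriction is there because the elements of \<open>BijGroup E\<close> are undefined
  outside \<open>E\<close>.\<close>

lemma (in group) group_actionI:
  assumes closed: "\<And>g x. g \<in> carrier G \<Longrightarrow> x \<in> E \<Longrightarrow> act g x \<in> E"
    and one: "\<And>x. x \<in> E \<Longrightarrow> act \<one> x = x"
    and mult: "\<And>g g' x. g \<in> carrier G \<Longrightarrow> g' \<in> carrier G \<Longrightarrow> x \<in> E \<Longrightarrow>
      act (g \<otimes> g') x = act g (act g' x)"
  shows "group_action G E (\<lambda>g. restrict (act g) E)"
proof -
  have "restrict (act g) E \<in> Bij E" if g: "g \<in> carrier G" for g
  proof -
    have "bij_betw (act g) E E"
    proof (rule bij_betw_byWitness[of _ "act (inv g)"])
      show "\<forall>x\<in>E. act (inv g) (act g x) = x" "\<forall>x\<in>E. act g (act (inv g) x) = x"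
        using g one by (auto simp flip: mult)
    qed (use g closed in auto)
    then show ?thesis by (simp add: Bij_def cong: bij_betw_cong)
  qed
  moreover have "restrict (act (g \<otimes> g')) E = compose E (restrict (act g) E) (restrict (act g') E)"
    if "g \<in> carrier G" "g' \<in> carrier G" for g g'
    using that closed by (auto simp: compose_def mult restrict_def fun_eq_iff)
  ultimately have "(\<lambda>g. restrict (act g) E) \<in> hom G (BijGroup E)"
    by (auto simp: hom_def BijGroup_def)
  then show ?thesis
    by (simp add: group_action_def group_hom_def group_hom_axioms_def is_group group_BijGroup)
qed

context vector_space
begin

text \<open>As an additive group \<open>W\<close> has exponent \<open>p\<close>, so its order is a
  power of \<open>p\<close>, and \<open>w\<close> makes it nontrivial.\<close>

lemma prime_dvd_card_subspace:
  assumes W: "subspace W" "finite W" "w \<in> W" "w \<noteq> 0"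
    and p: "Factorial_Ring.prime p" and char: "of_nat p = (0 :: 'a)"
  shows "p dvd card W"
proof -
  let ?G = "\<lparr>carrier = W, monoid.mult = (+), one = 0\<rparr>"
  interpret G: group ?G
  proof (rule groupI)
    fix x assume "x \<in> carrier ?G"
    then show "\<exists>y\<in>carrier ?G. y \<otimes>\<^bsub>?G\<^esub> x = \<one>\<^bsub>?G\<^esub>"
      using subspace_neg[OF W(1), of x] by (auto intro!: bexI[of _ "- x"])
  qed (use W in \<open>auto simp: subspace_add subspace_0 add.assoc\<close>)
  have pow: "x [^]\<^bsub>?G\<^esub> n = scale (of_nat n) x" for x and n :: nat
    by (induction n) (simp_all add: scale_left_distrib add.commute)
  have "\<exists>t. order ?G = p ^ t"
    using G.order_eq_prime_power[OF _ p, of 1] W(2) char by (simp add: pow)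
  then obtain t where t: "card W = p ^ t" by (auto simp: order_def)
  have "card {0, w} \<le> card W" using W by (intro card_mono) (auto simp: subspace_0)
  then have "t \<noteq> 0" using W(4) t by (intro notI) simp
  then show ?thesis using t by simp
qed

text \<open>A basis of positive cardinality is finite, since \<open>card\<close> is 0 on infinite
  sets.\<close>

lemma finite_UNIV_if_dim_pos:
  assumes "finite (UNIV :: 'a set)" and "dim (UNIV :: 'b set) > 0"
  shows "finite (UNIV :: 'b set)"
proof -
  obtain B where B: "UNIV \<subseteq> span B" "card B = dim (UNIV :: 'b set)"
    by (metis basis_exists)
  then have finB: "finite B" using assms(2) by (intro card_ge_0_finite) simp
  have "finite ((\<lambda>u. \<Sum>v\<in>B. scale (u v) v) ` (PiE B (\<lambda>_. UNIV)))"
    using finB assms(1) by (intro finite_imageI finite_PiE) auto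
  moreover have "v \<in> (\<lambda>u. \<Sum>v\<in>B. scale (u v) v) ` (PiE B (\<lambda>_. UNIV))" for v
  proof -
    obtain u where "v = (\<Sum>v\<in>B. scale (u v) v)" using B(1) span_finite[OF finB] by auto
    then have "v = (\<Sum>v\<in>B. scale (restrict u B v) v)" by simp
    then show ?thesis by (intro image_eqI[of _ _ "restrict u B"]) auto
  qed
  ultimately show ?thesis by (metis finite_subset subsetI)
qed

end

text \<open>Hyperbolic pairs \<open>e i\<close>, \<open>f i\<close> such that \<open>P\<close> acts
  unitriangularly on the span of the \<open>e i\<close>. The action on the \<open>f i\<close> is
  left free; duality controls it once the frame is complete.\<close>

locale adapted_frame = symplectic_space scale form
  for scale :: "'f::field \<Rightarrow> 'v::ab_group_add \<Rightarrow> 'v" and form :: "'v \<Rightarrow> 'v \<Rightarrow> 'f" +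
  fixes P :: "('v \<Rightarrow> 'v) set" and k :: nat and e f :: "nat \<Rightarrow> 'v"
  assumes subgroup_P: "subgroup P (Sp scale form)"
    and ee: "\<And>i l. i < k \<Longrightarrow> l < k \<Longrightarrow> form (e i) (e l) = 0"
    and ff: "\<And>i l. i < k \<Longrightarrow> l < k \<Longrightarrow> form (f i) (f l) = 0"
    and ef: "\<And>i l. i < k \<Longrightarrow> l < k \<Longrightarrow> form (e i) (f l) = (if i = l then 1 else 0)"
    and flag: "\<And>a i. a \<in> P \<Longrightarrow> i < k \<Longrightarrow> a (e i) - e i \<in> span (e ` {..<i})"
begin

lemma fe: "i < k \<Longrightarrow> l < k \<Longrightarrow> form (f i) (e l) = (if i = l then - 1 else 0)"
  using ef[of l i] form_skew[of "f i" "e l"] by auto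

lemma P_Sp: "a \<in> P \<Longrightarrow> a \<in> carrier (Sp scale form)"
  using subgroup.subset[OF subgroup_P] by blast

definition perp :: "'v set" where
  "perp = {v. \<forall>i<k. form v (e i) = 0 \<and> form v (f i) = 0}"

text \<open>The orthogonal projection onto \<open>perp\<close>; the plus sign reflects
  \<open>form (f i) (e i) = - 1\<close>.\<close>

definition proj :: "'v \<Rightarrow> 'v" where
  "proj v = v - (\<Sum>i<k. scale (form v (f i)) (e i)) + (\<Sum>i<k. scale (form v (e i)) (f i))"

lemma proj_add: "proj (v + w) = proj v + proj w"
  by (simp add: proj_def form_simps scale_left_distrib sum.distrib)

lemma proj_scale: "proj (scale c v) = scale c (proj v)"
  by (simp add: proj_def form_simps scale_right_distrib scale_right_diff_distrib scale_sum_right)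

lemma sum_delta_lessThan: "l < k \<Longrightarrow> (\<Sum>i<k. g i * (if i = l then c else 0)) = g l * (c :: 'f)"
  by (simp add: if_distrib[of "(*) _"] cong: if_cong)

lemma proj_in_perp: "proj v \<in> perp"
  by (auto simp: perp_def proj_def form_simps ee ff ef fe sum_delta_lessThan)

lemma proj_perp: "v \<in> perp \<Longrightarrow> proj v = v"
  by (simp add: perp_def proj_def)

lemma proj_e: "i < k \<Longrightarrow> proj (e i) = 0"
  by (simp add: proj_def ee ef if_distrib[of "\<lambda>c. scale c _"] cong: if_cong)

lemma proj_span_e: "x \<in> span (e ` {..<k}) \<Longrightarrow> proj x = 0"
proof (induction rule: span_induct_alt)
  case base
  show ?case by (simp add: proj_def)
next
  case (step c x y)
  then show ?case by (auto simp: proj_add proj_scale proj_e)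
qed

lemma subspace_perp: "subspace perp"
  by (auto simp: subspace_def perp_def form_simps)

lemma form_span_zero:
  assumes "x \<in> span S" "\<And>s. s \<in> S \<Longrightarrow> form y s = 0"
  shows "form y x = 0"
  using assms(1) by (induction rule: span_induct_alt) (auto simp: form_simps assms(2))

lemma P_e: "a \<in> P \<Longrightarrow> i < k \<Longrightarrow> a (e i) \<in> span (e ` {..i})"
proof -
  assume a: "a \<in> P" and i: "i < k"
  have "a (e i) - e i \<in> span (e ` {..i})"
    using flag[OF a i] by (rule subsetD[OF span_mono[OF image_mono], rotated]) auto
  then have "(a (e i) - e i) + e i \<in> span (e ` {..i})" by (rule span_add) (auto intro: span_base)
  then show ?thesis by simp
qed

lemma P_span_e:
  assumes a: "a \<in> P" and x: "x \<in> span (e ` {..<k})"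
  shows "a x \<in> span (e ` {..<k})"
  using x
proof (induction rule: span_induct_alt)
  case base
  show ?case by (simp add: Sp_zero[OF P_Sp[OF a]] span_zero)
next
  case (step c x y)
  then obtain i where i: "i < k" "x = e i" by auto
  have "a x \<in> span (e ` {..<k})"
    unfolding i(2) using P_e[OF a i(1)]
    by (rule subsetD[OF span_mono[OF image_mono], rotated]) (use i in auto)
  then show ?case
    using step by (simp add: Sp_add[OF P_Sp[OF a]] Sp_scale[OF P_Sp[OF a]] span_add span_scale)
qed

text \<open>\<open>P\<close> preserves the span of the \<open>e i\<close> and hence its orthogonal
  space, so \<open>a v\<close> has no components along the \<open>f i\<close>.\<close>

lemma proj_P_perp:
  assumes a: "a \<in> P" and v: "v \<in> perp"
  shows "proj (a v) - a v \<in> span (e ` {..<k})"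
proof -
  have "form (a v) (e i) = 0" if i: "i < k" for i
  proof -
    have "form v ((inv\<^bsub>Sp scale form\<^esub> a) (e i)) = 0"
      by (rule form_span_zero[OF P_e[OF subgroup.m_inv_closed[OF subgroup_P a] i]])
        (use v i in \<open>auto simp: perp_def\<close>)
    then show ?thesis using Sp_adjoint[OF P_Sp[OF a]] by simp
  qed
  then have "proj (a v) - a v = - (\<Sum>i<k. scale (form (a v) (f i)) (e i))"
    by (simp add: proj_def)
  also have "\<dots> \<in> span (e ` {..<k})"
    by (intro span_neg span_sum span_scale span_base) auto
  finally show ?thesis .
qed

text \<open>Makes \<open>proj (a v)\<close> an action of \<open>P\<close> on \<open>perp\<close>:
  the error of the inner projection lies in the span of the \<open>e i\<close>, which
  \<open>P\<close> preserves and \<open>proj\<close> kills.\<close>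

lemma proj_P_proj:
  assumes a: "a \<in> P" and c: "c \<in> P" and v: "v \<in> perp"
  shows "proj (a (proj (c v))) = proj (a (c v))"
proof -
  have "a (proj (c v)) = a (c v) + a (proj (c v) - c v)"
    by (simp add: Sp_diff[OF P_Sp[OF a]])
  then show ?thesis
    using proj_span_e[OF P_span_e[OF a proj_P_perp[OF c v]]] by (simp add: proj_add)
qed

text \<open>The \<open>p\<close>-group \<open>P\<close> acts on \<open>perp\<close> through
  \<open>proj\<close>, fixing 0, and \<open>p\<close> divides \<open>card perp\<close>, so there is
  a second fixed point.\<close>

lemma exists_fixed_mod_span:
  assumes fin: "finite (UNIV :: 'v set)" and p: "Factorial_Ring.prime p" and char: "of_nat p = (0 :: 'f)"
    and P: "card P = p ^ t" and w: "w \<in> perp" "w \<noteq> 0"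
  shows "\<exists>v\<in>perp. v \<noteq> 0 \<and> (\<forall>a\<in>P. a v - v \<in> span (e ` {..<k}))"
proof -
  let ?G = "Sp scale form\<lparr>carrier := P\<rparr>"
  interpret G: group ?G
    using subgroup_P group.subgroup_imp_group group_Sp by blast
  interpret group_action ?G perp "\<lambda>a. restrict (\<lambda>v. proj (a v)) perp"
    by (rule G.group_actionI) (auto simp: proj_in_perp one_Sp mult_Sp proj_perp proj_P_proj)
  have finW: "finite perp" by (rule finite_subset[OF subset_UNIV fin])
  obtain v where v: "v \<in> perp" "v \<noteq> 0" "\<And>a. a \<in> P \<Longrightarrow> proj (a v) = v"
    using p_group_second_fixed_point[OF p _ finW, of t 0]
      prime_dvd_card_subspace[OF subspace_perp finW w p char] P subspace_0[OF subspace_perp]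
    by (auto simp: order_def Sp_zero[OF P_Sp] proj_perp)
  have "a v - v \<in> span (e ` {..<k})" if a: "a \<in> P" for a
    using span_neg[OF proj_P_perp[OF a v(1)]] by (simp add: v(3)[OF a])
  then show ?thesis using v by blast
qed

lemma extend_frame:
  assumes fin: "finite (UNIV :: 'v set)" and p: "Factorial_Ring.prime p" and char: "of_nat p = (0 :: 'f)"
    and P: "card P = p ^ t" and w: "w \<in> perp" "w \<noteq> 0"
  shows "\<exists>e' f'. adapted_frame scale form P (Suc k) e' f'"
proof -
  obtain v where v: "v \<in> perp" "v \<noteq> 0" "\<And>a. a \<in> P \<Longrightarrow> a v - v \<in> span (e ` {..<k})"
    using exists_fixed_mod_span[OF assms] by blast
  obtain u where u: "form v u \<noteq> 0" using nondegenerate v(2) by blast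
  \<comment> \<open>Projecting \<open>u\<close> makes it orthogonal to the old frame without
    changing its pairing with \<open>v\<close>; scaling makes that pairing 1.\<close>
  define g where "g = scale (1 / form v u) (proj u)"
  have g: "g \<in> perp" unfolding g_def by (intro subspace_scale[OF subspace_perp] proj_in_perp)
  have "form v (proj u) = form v u"
    using v(1) by (simp add: proj_def perp_def form_simps)
  then have vg: "form v g = 1" using u by (simp add: g_def form_scale_right)
  have orth: "form v (e i) = 0" "form v (f i) = 0" "form g (e i) = 0" "form g (f i) = 0"
    "form (e i) v = 0" "form (f i) v = 0" "form (e i) g = 0" "form (f i) g = 0" if "i < k" for i
    using v(1) g that form_skew[of "e i"] form_skew[of "f i"] by (auto simp: perp_def)
  have img: "e(k := v) ` {..<i} = e ` {..<i}" if "i \<le> k" for i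
    using that by auto
  have "adapted_frame scale form P (Suc k) (e(k := v)) (f(k := g))"
  proof (intro adapted_frame.intro adapted_frame_axioms.intro symplectic_space_axioms)
    show "a ((e(k := v)) i) - (e(k := v)) i \<in> span (e(k := v) ` {..<i})"
      if "a \<in> P" "i < Suc k" for a i
      using that v(3) flag by (cases "i = k") (auto simp: img)
  qed (auto simp: less_Suc_eq subgroup_P ee ff ef vg orth alternating)
  then show ?thesis by blast
qed

lemma spanning_if_perp_trivial:
  assumes "\<And>w. w \<in> perp \<Longrightarrow> w = 0"
  shows "dim (UNIV :: 'v set) \<le> 2 * k"
proof -
  let ?A = "e ` {..<k} \<union> f ` {..<k}"
  have "v \<in> span ?A" for v
  proof -
    have "proj v = 0" using assms proj_in_perp by blast
    then have "v = (\<Sum>i<k. scale (form v (f i)) (e i)) - (\<Sum>i<k. scale (form v (e i)) (f i))"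
      by (simp add: proj_def algebra_simps)
    also have "\<dots> \<in> span ?A"
      by (intro span_diff span_sum span_scale span_base) auto
    finally show ?thesis .
  qed
  then have "dim (UNIV :: 'v set) \<le> card ?A" by (intro dim_le_card) auto
  also have "\<dots> \<le> card (e ` {..<k}) + card (f ` {..<k})" by (rule card_Un_le)
  also have "\<dots> \<le> 2 * k"
    using card_image_le[of "{..<k}" e] card_image_le[of "{..<k}" f] by simp
  finally show ?thesis .
qed

text \<open>Pairing a linear relation with each \<open>f l\<close> and \<open>e l\<close> isolates
  its coefficients, so the frame is independent.\<close>

lemma length_le_dim:
  assumes fin: "finite (UNIV :: 'v set)"
  shows "2 * k \<le> dim (UNIV :: 'v set)"
proof -
  let ?A = "e ` {..<k} \<union> f ` {..<k}"
  have inj: "inj_on e {..<k}" "inj_on f {..<k}"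
    by (auto intro!: inj_onI) (metis ef zero_neq_one)+
  have disj: "e ` {..<k} \<inter> f ` {..<k} = {}"
  proof (rule ccontr)
    assume "e ` {..<k} \<inter> f ` {..<k} \<noteq> {}"
    then obtain i l where "i < k" "l < k" "e i = f l" by auto
    then show False using ef[of i i] ff[of l i] by simp
  qed
  have indep: "independent ?A"
  proof (rule independent_if_scalars_zero)
    fix u x assume sum: "(\<Sum>x\<in>?A. scale (u x) x) = 0" and x: "x \<in> ?A"
    have "form (\<Sum>x\<in>?A. scale (u x) x) y = (\<Sum>i<k. u (e i) * form (e i) y) + (\<Sum>i<k. u (f i) * form (f i) y)" for y
      using disj by (simp add: form_simps sum.union_disjoint sum.reindex inj)
    then have zero: "(\<Sum>i<k. u (e i) * form (e i) y) + (\<Sum>i<k. u (f i) * form (f i) y) = 0" for y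
      using sum by simp
    have "u (e l) = 0" "u (f l) = 0" if "l < k" for l
      using zero[of "f l"] zero[of "e l"] that by (simp_all add: ee ef fe ff sum_delta_lessThan)
    then show "u x = 0" using x by auto
  qed simp
  obtain B where B: "UNIV \<subseteq> span B" "card B = dim (UNIV :: 'v set)"
    by (metis basis_exists)
  have "finite B" by (rule finite_subset[OF subset_UNIV fin])
  then have "card ?A \<le> card B" using independent_span_bound[OF _ indep, of B] B(1) by blast
  moreover have "card ?A = 2 * k"
    using disj by (simp add: card_Un_disjoint card_image inj)
  ultimately show ?thesis using B(2) by simp
qed

end

section \<open>Existence of an adapted symplectic basis\<close>

context symplectic_space
begin

lemma exists_adapted_frame:
  assumes fin: "finite (UNIV :: 'v set)" and p: "Factorial_Ring.prime p" and char: "of_nat p = (0 :: 'f)"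
    and P: "subgroup P (Sp scale form)" "card P = p ^ t" and dim: "dim (UNIV :: 'v set) = 2 * n"
  shows "k \<le> n \<Longrightarrow> \<exists>e f. adapted_frame scale form P k e f"
proof (induction k)
  case 0
  have "adapted_frame scale form P 0 (\<lambda>_. 0) (\<lambda>_. 0)"
    by (intro adapted_frame.intro adapted_frame_axioms.intro symplectic_space_axioms) (auto simp: P)
  then show ?case by blast
next
  case (Suc k)
  then obtain e f where "adapted_frame scale form P k e f" by auto
  then interpret adapted_frame scale form P k e f .
  obtain w where "w \<in> perp" "w \<noteq> 0" using spanning_if_perp_trivial dim Suc.prems by force
  then show ?case by (rule extend_frame[OF fin p char P(2)])
qed

lemma exists_adapted_symplectic_basis:
  assumes fin: "finite (UNIV :: 'v set)" and p: "Factorial_Ring.prime p" and char: "of_nat p = (0 :: 'f)"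
    and P: "subgroup P (Sp scale form)" "card P = p ^ t" and dim: "dim (UNIV :: 'v set) = 2 * h + 2"
  shows "\<exists>b. symplectic_basis scale form h b \<and> P \<subseteq> symplectic_basis.unip scale form h b"
proof -
  obtain e f where "adapted_frame scale form P (Suc h) e f"
    using exists_adapted_frame[OF fin p char P, of "Suc h" "Suc h"] dim by auto
  then interpret F: adapted_frame scale form P "Suc h" e f .
  \<comment> \<open>A nonzero \<open>w\<close> would extend the frame to \<open>2 * h + 4\<close>
    independent vectors.\<close>
  have perp: "w = 0" if w: "w \<in> F.perp" for w
  proof (rule ccontr)
    assume "w \<noteq> 0"
    then obtain e' f' where "adapted_frame scale form P (Suc (Suc h)) e' f'"
      using F.extend_frame[OF fin p char P(2) w] by blast
    then show False using adapted_frame.length_le_dim[of scale form P "Suc (Suc h)" e' f'] fin dim by simp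
  qed
  \<comment> \<open>The order is \<open>e 0, ..., e h, f h, ..., f 0\<close>, which makes the form
    antidiagonal.\<close>
  define b where "b i = (if i \<le> h then e i else f (2 * h + 1 - i))" for i
  interpret B: symplectic_basis scale form h b
  proof unfold_locales
    show "finite (UNIV :: 'v set)" by (rule fin)
    show "form (b i) (b l) = (if i + l = 2 * h + 1 then if i < l then 1 else - 1 else 0)"
      if "i \<le> 2 * h + 1" "l \<le> 2 * h + 1" for i l
      using that by (auto simp: b_def F.ee F.ff F.ef F.fe)
    show "v = 0" if v: "\<And>i. i \<le> 2 * h + 1 \<Longrightarrow> form v (b i) = 0" for v
    proof (rule perp)
      have "form v (e i) = 0" "form v (f i) = 0" if "i < Suc h" for i
        using v[of i] v[of "2 * h + 1 - i"] that by (auto simp: b_def split: if_splits)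
      then show "v \<in> F.perp" by (simp add: F.perp_def)
    qed
  qed
  have "a \<in> B.unip" if a: "a \<in> P" for a
  proof (rule B.unipI)
    show "a \<in> carrier (Sp scale form)" by (rule F.P_Sp[OF a])
    fix i assume i: "i \<le> 2 * h + 1"
    show "a (b i) - b i \<in> B.fil i"
    proof (cases "i \<le> h")
      case True
      have "x \<in> B.fil i" if "x \<in> span (e ` {..<i})" for x
        using that
      proof (induction rule: span_induct_alt)
        case base
        show ?case by (rule B.zero_in_fil)
      next
        case (step c x y)
        then obtain l where l: "l < i" "x = b l" using True by (auto simp: b_def)
        then have "x \<in> B.fil i" using i by (simp add: B.b_in_fil)
        then show ?case using step by (auto intro: B.fil_add B.fil_scale)
      qed
      then show ?thesis using F.flag[OF a, of i] True by (simp add: b_def)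
    next
      case False
      define i' where "i' = 2 * h + 1 - i"
      \<comment> \<open>Moving \<open>a\<close> to the other side turns this into the pairing of
        \<open>f i'\<close> with a vector in the span of the \<open>e l\<close> with
        \<open>l < m\<close>, where \<open>m \<le> i'\<close>.\<close>
      have "form (a (f i') - f i') (e m) = 0" if m: "m \<le> i'" for m
      proof -
        have lt: "i' < Suc h" "m < Suc h" using False m by (auto simp: i'_def)
        let ?a' = "inv\<^bsub>Sp scale form\<^esub> a"
        have "?a' \<in> P" by (rule subgroup.m_inv_closed[OF P(1) a])
        then have "form (f i') (?a' (e m) - e m) = 0"
          using lt m by (intro F.form_span_zero[OF F.flag]) (auto simp: F.fe)
        then show ?thesis
          using Sp_adjoint[OF F.P_Sp[OF a], of "f i'" "e m"] by (simp add: form_simps)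
      qed
      then show ?thesis
        using False i by (auto simp: B.fil_def B.coef_def b_def i'_def)
    qed
  qed
  then show ?thesis using B.symplectic_basis_axioms by blast
qed

end

section \<open>Sylow subgroups of the symplectic and projective symplectic groups\<close>

theorem theorem5p1:
  fixes scale :: "'f::{field,finite} \<Rightarrow> 'v::ab_group_add \<Rightarrow> 'v"
    and form :: "'v \<Rightarrow> 'v \<Rightarrow> 'f"
    and p k j :: nat
  assumes "Factorial_Ring.prime p" and "p > 3" and "[p = 1] (mod 4)"
    and "odd k" and "CARD('f) = p ^ k"
    and "j > 0"
    and "symplectic_space scale form"
    and "vector_space.dim scale (UNIV :: 'v set) = p ^ j + 1"
  shows "(\<forall>P. sylow_subgroup p (Sp scale form) P \<longrightarrow>
              \<not> FSZ (p ^ j) (Sp scale form \<lparr>carrier := P\<rparr>)) \<and>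
         (\<forall>P. sylow_subgroup p (PSp scale form) P \<longrightarrow>
              \<not> FSZ (p ^ j) (PSp scale form \<lparr>carrier := P\<rparr>))"
proof -
  interpret symplectic_space scale form by (rule assms(7))
  interpret S: group "Sp scale form" by (rule group_Sp)
  interpret PS: group "PSp scale form" by (rule group_PSp)
  let ?Z = "group_center (Sp scale form)"
  have fin: "finite (UNIV :: 'v set)" using assms(8) by (intro finite_UNIV_if_dim_pos) auto
  note finS = finite_carrier_Sp[OF fin]
  have p0: "of_nat p = (0 :: 'f)"
    using of_nat_CHAR[where ?'a = 'f] finite_field_CHAR[OF assms(1,5)] by simp
  have "odd (p ^ j)" using assms(1,2) prime_odd_nat by simp
  then obtain h where h: "p ^ j = 2 * h + 1" by (rule oddE)
  have Sp: "\<not> FSZ (p ^ j) (Sp scale form \<lparr>carrier := P\<rparr>)"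
    if P: "sylow_subgroup p (Sp scale form) P" for P
  proof -
    obtain b where b: "symplectic_basis scale form h b" "P \<subseteq> symplectic_basis.unip scale form h b"
      using exists_adapted_symplectic_basis[OF fin assms(1) p0, of P "multiplicity p (order (Sp scale form))" h]
        P assms(8) h by (auto simp: sylow_subgroup_def)
    interpret symplectic_basis scale form h b by (rule b(1))
    interpret symplectic_basis_finite_field scale form h b p k j
      by unfold_locales (use assms h in auto)
    have "P = unip" using sylow_subgroup_eq_unip P b(2) by blast
    then show ?thesis using not_FSZ_unip by simp
  qed
  \<comment> \<open>The center has exponent dividing 2 and \<open>p\<close> is odd.\<close>
  have "\<not> p dvd card ?Z"
  proof
    assume "p dvd card ?Z"
    have Z: "subgroup ?Z (Sp scale form)"
      using S.group_center_normal by (rule normal_imp_subgroup)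
    interpret Z: group "Sp scale form \<lparr>carrier := ?Z\<rparr>" using Z by (rule S.subgroup_imp_group)
    have "p dvd 2"
    proof (rule Z.prime_dvd_order_imp_dvd_exponent[OF _ _ assms(1)])
      show "finite (carrier (Sp scale form \<lparr>carrier := ?Z\<rparr>))"
        using finS by (auto simp: group_center_def)
      show "x [^]\<^bsub>Sp scale form \<lparr>carrier := ?Z\<rparr>\<^esub> (2::nat) = \<one>\<^bsub>Sp scale form \<lparr>carrier := ?Z\<rparr>\<^esub>"
        if "x \<in> carrier (Sp scale form \<lparr>carrier := ?Z\<rparr>)" for x
        unfolding S.nat_pow_consistent[symmetric] pow_Sp
        using center_Sp_square[OF fin, of x] that by (simp add: one_Sp numeral_2_eq_2)
      show "p dvd order (Sp scale form \<lparr>carrier := ?Z\<rparr>)"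
        using \<open>p dvd card ?Z\<close> by (simp add: order_def)
    qed
    then show False using assms(2) by (auto dest: dvd_imp_le)
  qed
  note lift = S.sylow_subgroup_FactGroup_iso[OF finS assms(1) S.group_center_normal this]
  have "\<not> FSZ (p ^ j) (PSp scale form \<lparr>carrier := Q\<rparr>)"
    if Q: "sylow_subgroup p (PSp scale form) Q" for Q
  proof
    assume FSZ: "FSZ (p ^ j) (PSp scale form \<lparr>carrier := Q\<rparr>)"
    \<comment> \<open>Dividing out a center of order prime to \<open>p\<close> identifies
      \<open>Q\<close> with a Sylow subgroup upstairs.\<close>
    obtain P where P: "sylow_subgroup p (Sp scale form) P"
      "(\<lambda>x. ?Z #>\<^bsub>Sp scale form\<^esub> x) \<in> iso (Sp scale form\<lparr>carrier := P\<rparr>) (PSp scale form\<lparr>carrier := Q\<rparr>)"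
      using lift[of Q] Q by (auto simp: PSp_def)
    have "FSZ (p ^ j) (Sp scale form\<lparr>carrier := P\<rparr>)"
    proof (rule FSZ_iso[OF _ _ P(2) FSZ])
      show "group (Sp scale form\<lparr>carrier := P\<rparr>)"
        using P(1) S.subgroup_imp_group by (simp add: sylow_subgroup_def)
      show "group (PSp scale form\<lparr>carrier := Q\<rparr>)"
        using Q PS.subgroup_imp_group by (simp add: sylow_subgroup_def)
    qed
    then show False using Sp[OF P(1)] by simp
  qed
  then show ?thesis using Sp by blast
qed

end
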